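(* For all integers $n,k$ with $n\geq 2k\geq 2$, $$\sum_{m=0}^{\lfloor n/2\rfloor}(-1)^m\binom{n}{2m}\int_0^\infty [\pi I_0(t)]^{n-2m}[K_0(t)]^{n+2m}\,t^{n-2k}\,dt=0.$$
   Context: $I_0$ and $K_0$ are the modified Bessel functions of order zero, given for $t>0$ by $I_0(t)=\frac1\pi\int_0^\pi e^{t\cos\theta}\,d\theta$ and $K_0(t)=\int_0^\infty e^{-t\cosh u}\,du$. $\binom{n}{j}=\frac{n!}{j!(n-j)!}$ is the binomial coefficient, and $\lfloor x\rfloor$ is the greatest integer less than or equal to $x$. *)

theory Defs
  imports "HOL-Analysis.Analysis"
begin

text \<open>
  The modified Bessel functions of order zero through their classical integral representations.
  Both definitions are total on the reals, but are meaningful as Bessel functions only for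
  \<open>t > 0\<close>: for \<open>t \<le> 0\<close> the integral defining \<open>bessel_K0\<close> diverges.
\<close>

definition bessel_I0 :: "real \<Rightarrow> real" where
  "bessel_I0 t = (1 / pi) * (LBINT \<theta>:{0..pi}. exp (t * cos \<theta>))"

definition bessel_K0 :: "real \<Rightarrow> real" where
  "bessel_K0 t = (LBINT u:{0..}. exp (- t * cosh u))"

text \<open>
  The truncated subtractions are exact where they are used: \<open>2 * m \<le> n\<close> and \<open>2 * k \<le> n\<close>.
\<close>

definition bessel_moment_integrand :: "nat \<Rightarrow> nat \<Rightarrow> nat \<Rightarrow> real \<Rightarrow> real" where
  "bessel_moment_integrand n k m t =
     (pi * bessel_I0 t) ^ (n - 2 * m) * bessel_K0 t ^ (n + 2 * m) * t ^ (n - 2 * k)"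

end

theory Submission
  imports Defs "HOL-Complex_Analysis.Complex_Analysis" "HOL-Real_Asymp.Real_Asymp"
begin

text \<open>
  Continuing \<open>K\<^sub>0\<close> analytically to the lower half-plane, the product \<open>F z = K\<^sub>0 z * K\<^sub>0 (- z)\<close> is
  holomorphic in the open upper half-plane, equals \<open>K\<^sub>0 t * (K\<^sub>0 t + \<i> \<pi> I\<^sub>0 t)\<close> on the positive real
  axis, and takes the real values \<open>\<bar>K\<^sub>0 (\<i> y)\<bar>\<^sup>2\<close> on the positive imaginary axis. Since
  \<open>(- \<i>) ^ n * F t ^ n = K\<^sub>0 t ^ n * (\<pi> I\<^sub>0 t - \<i> K\<^sub>0 t) ^ n\<close>, the claimed sum is the real part of
  \<open>(- \<i>) ^ n\<close> times the integral of \<open>F t ^ n * t ^ (n - 2 * k)\<close>. Rotating the ray of integration to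
  the imaginary axis turns the integral into a real multiple of \<open>\<i> ^ (n - 2 * k + 1)\<close>, and the
  real part vanishes. The rotation is licensed by \<open>F z = O(\<bar>z\<bar> powr (- \<delta>))\<close> for every \<open>0 < \<delta> < 1\<close>,
  with \<open>\<delta>\<close> near \<open>0\<close> used at the origin and \<open>\<delta>\<close> near \<open>1\<close> at infinity.
\<close>

section \<open>Holomorphic dependence of an integral on a parameter\<close>

text \<open>Cauchy's inequality turns the majorant \<open>g\<close> of the functions into a majorant
  \<open>g / r\<close> of their derivatives, hence of the difference quotients near
  \<open>z0\<close>. Dominated convergence along sequences tending to \<open>z0\<close> then moves
  the derivative inside the integral.\<close>

lemma holomorphic_on_lebesgue_integral:
  fixes f :: "complex \<Rightarrow> 'a \<Rightarrow> complex"
  assumes "open S"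
    and meas: "\<And>z. z \<in> S \<Longrightarrow> f z \<in> borel_measurable M"
    and hol: "\<And>x. x \<in> space M \<Longrightarrow> (\<lambda>z. f z x) holomorphic_on S"
    and int: "integrable M g"
    and bound: "\<And>z x. z \<in> S \<Longrightarrow> x \<in> space M \<Longrightarrow> norm (f z x) \<le> g x"
  shows "(\<lambda>z. \<integral>x. f z x \<partial>M) holomorphic_on S"
proof -
  have "(\<lambda>z. \<integral>x. f z x \<partial>M) field_differentiable (at z0)" if z0: "z0 \<in> S" for z0
  proof -
    from \<open>open S\<close> z0 obtain R where R: "R > 0" "cball z0 R \<subseteq> S"
      using open_contains_cball by blast
    \<comment> \<open>Half the radius, so that a disc of radius \<open>r\<close> around any point of
      \<open>ball z0 r\<close> still lies in \<open>S\<close>.\<close>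
    define r where "r = R / 2"
    have r: "r > 0" "\<And>z. z \<in> ball z0 r \<Longrightarrow> cball z r \<subseteq> S"
    proof -
      show "r > 0" using R by (simp add: r_def)
      show "cball z r \<subseteq> S" if "z \<in> ball z0 r" for z
      proof
        fix w assume "w \<in> cball z r"
        then have "dist z0 w \<le> R"
          using dist_triangle[of z0 w z] that by (simp add: r_def)
        then show "w \<in> S" using R by auto
      qed
    qed
    define D where "D x = deriv (\<lambda>z. f z x) z0" for x
    have der: "((\<lambda>z. f z x) has_field_derivative deriv (\<lambda>z. f z x) z) (at z)"
      if "x \<in> space M" "z \<in> S" for x z
      using holomorphic_derivI[OF hol \<open>open S\<close>] that by blast
    have dbound: "norm (deriv (\<lambda>z. f z x) z) \<le> g x / r" if "x \<in> space M" "z \<in> ball z0 r" for x z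
    proof -
      have "norm ((deriv ^^ 1) (\<lambda>z. f z x) z) \<le> fact 1 * g x / r ^ 1"
      proof (rule Cauchy_inequality)
        show "(\<lambda>z. f z x) holomorphic_on ball z r"
          using hol[OF that(1)] r(2)[OF that(2)] by (meson ball_subset_cball holomorphic_on_subset)
        show "continuous_on (cball z r) (\<lambda>z. f z x)"
          using hol[OF that(1)] r(2)[OF that(2)]
          by (meson holomorphic_on_imp_continuous_on holomorphic_on_subset)
        show "norm (f w x) \<le> g x" if "norm (z - w) = r" for w
          using r(2)[OF \<open>z \<in> ball z0 r\<close>] \<open>x \<in> space M\<close> that
          by (intro bound) (auto simp: dist_norm subset_iff)
      qed (use r in auto)
      then show ?thesis by simp
    qed
    have lip: "norm (f z x - f z0 x) \<le> g x / r * norm (z - z0)"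
      if "x \<in> space M" "z \<in> ball z0 r" for x z
    proof (rule field_differentiable_bound[of "ball z0 r"])
      show "((\<lambda>z. f z x) has_field_derivative deriv (\<lambda>z. f z x) w) (at w within ball z0 r)"
        if "w \<in> ball z0 r" for w
      proof -
        have "w \<in> S" using r(2)[OF that] r(1) by auto
        then show ?thesis using der[OF \<open>x \<in> space M\<close>] has_field_derivative_at_within by blast
      qed
    qed (use that dbound r in auto)
    have fint: "integrable M (f z)" if "z \<in> S" for z
      by (rule Bochner_Integration.integrable_bound[OF int])
        (use meas bound that in \<open>auto intro!: AE_I2 order.trans[OF _ abs_ge_self]\<close>)
    have "((\<lambda>z. \<integral>x. f z x \<partial>M) has_field_derivative (\<integral>x. D x \<partial>M)) (at z0)"
      unfolding has_field_derivative_iff tendsto_at_iff_sequentially o_def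
    proof (intro allI impI)
      fix X :: "nat \<Rightarrow> complex"
      assume X0: "\<forall>i. X i \<in> UNIV - {z0}" and X: "X \<longlonglongrightarrow> z0"
      have "eventually (\<lambda>i. X i \<in> ball z0 r) sequentially"
        using X r(1) by (intro topological_tendstoD[OF X]) auto
      then obtain N where N: "\<And>i. i \<ge> N \<Longrightarrow> X i \<in> ball z0 r"
        by (auto simp: eventually_sequentially)
      define Y where "Y i = X (i + N)" for i
      have Y: "Y i \<in> ball z0 r" "Y i \<noteq> z0" "Y i \<in> S" for i
        using N[of "i + N"] X0 r(2)[of "Y i"] r(1) by (auto simp: Y_def)
      have Ylim: "Y \<longlonglongrightarrow> z0" unfolding Y_def using X by (rule LIMSEQ_ignore_initial_segment)
      have lim: "(\<lambda>i. (f (Y i) x - f z0 x) / (Y i - z0)) \<longlonglongrightarrow> D x" if "x \<in> space M" for x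
      proof -
        have "((\<lambda>z. (f z x - f z0 x) / (z - z0)) \<longlongrightarrow> D x) (at z0)"
          using der[OF that z0] by (simp add: has_field_derivative_iff D_def)
        moreover have "filterlim Y (at z0) sequentially"
          using Ylim Y(2) by (simp add: filterlim_at)
        ultimately show ?thesis by (rule filterlim_compose)
      qed
      have measq: "(\<lambda>x. (f (Y i) x - f z0 x) / (Y i - z0)) \<in> borel_measurable M" for i
        using meas[OF Y(3)] meas[OF z0] by measurable
      have "(\<lambda>i. \<integral>x. (f (Y i) x - f z0 x) / (Y i - z0) \<partial>M) \<longlonglongrightarrow> (\<integral>x. D x \<partial>M)"
      proof (rule integral_dominated_convergence)
        show "D \<in> borel_measurable M"
          by (rule borel_measurable_LIMSEQ_metric[OF measq lim])
        show "integrable M (\<lambda>x. g x / r)" using int by simp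
        show "AE x in M. norm ((f (Y i) x - f z0 x) / (Y i - z0)) \<le> g x / r" for i
          using lip[OF _ Y(1)] Y(2) by (intro AE_I2) (simp add: norm_divide divide_le_eq)
      qed (use measq lim in auto)
      moreover have "(\<integral>x. (f (Y i) x - f z0 x) / (Y i - z0) \<partial>M) =
          ((\<integral>x. f (Y i) x \<partial>M) - (\<integral>x. f z0 x \<partial>M)) / (Y i - z0)" for i
        using fint[OF Y(3)] fint[OF z0] by simp
      ultimately have "(\<lambda>i. ((\<integral>x. f (Y i) x \<partial>M) - (\<integral>x. f z0 x \<partial>M)) / (Y i - z0))
          \<longlonglongrightarrow> (\<integral>x. D x \<partial>M)"
        by (simp only:)
      then show "(\<lambda>i. ((\<integral>x. f (X i) x \<partial>M) - (\<integral>x. f z0 x \<partial>M)) / (X i - z0))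
          \<longlonglongrightarrow> (\<integral>x. D x \<partial>M)"
        unfolding Y_def by (rule LIMSEQ_offset)
    qed
    then show ?thesis by (auto simp: field_differentiable_def)
  qed
  then show ?thesis
    using \<open>open S\<close> by (simp add: holomorphic_on_def field_differentiable_at_within)
qed

section \<open>Principal square roots and a majorant of Beta type\<close>

lemma borel_measurable_csqrt [measurable]: "csqrt \<in> borel_measurable borel"
proof -
  have "(\<lambda>z. Re (csqrt z)) \<in> borel_measurable borel" "(\<lambda>z. Im (csqrt z)) \<in> borel_measurable borel"
    unfolding csqrt.simps by measurable
  then show ?thesis by (simp add: borel_measurable_complex_iff)
qed

lemma csqrt_of_real_mult: "0 \<le> c \<Longrightarrow> csqrt (of_real c * w) = of_real (sqrt c) * csqrt w"
proof (cases "c = 0")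
  case False
  assume "0 \<le> c"
  show ?thesis
  proof (rule csqrt_unique)
    show "(complex_of_real (sqrt c) * csqrt w)\<^sup>2 = of_real c * w"
      using \<open>0 \<le> c\<close> by (simp add: power_mult_distrib flip: of_real_power)
    show "0 < Re (of_real (sqrt c) * csqrt w) \<or>
        Re (of_real (sqrt c) * csqrt w) = 0 \<and> 0 \<le> Im (of_real (sqrt c) * csqrt w)"
      using csqrt_principal[of w] \<open>0 \<le> c\<close> False by (auto simp: zero_less_mult_iff)
  qed
qed auto

text \<open>Change of variables and gauge integrals of nonnegative functions yield integrability
  over the completed measure; this carries it to and from \<open>lborel\<close>.\<close>

lemma set_integrable_lborel_iff_lebesgue:
  fixes f :: "real \<Rightarrow> real"
  assumes [measurable]: "S \<in> sets borel" "f \<in> borel_measurable borel"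
  shows "set_integrable lborel S f \<longleftrightarrow> f absolutely_integrable_on S"
  unfolding set_integrable_def by (subst integrable_completion) auto

text \<open>Majorant of the kernel for all unit \<open>u\<close> at once:
  \<open>\<bar>y - 1\<bar> powr (-1/2)\<close> is the worst case of the root of
  \<open>y + u\<close>, and the extra \<open>y powr (- \<delta>)\<close> is what is kept of the
  exponential.\<close>

definition beta_weight :: "real \<Rightarrow> real \<Rightarrow> real" where
  "beta_weight \<delta> y = y powr (-1/2 - \<delta>) * \<bar>y - 1\<bar> powr (-1/2)"

lemma beta_weight_measurable [measurable]: "beta_weight \<delta> \<in> borel_measurable borel"
  unfolding beta_weight_def by measurable

lemma beta_weight_nonneg: "0 \<le> beta_weight \<delta> y"
  by (simp add: beta_weight_def)

text \<open>Near the origin this is the Beta integrand with parameters \<open>1/2 - \<delta>\<close>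
  and \<open>1/2\<close>; the inversion \<open>y = 1 / t\<close> turns the part beyond
  \<open>1\<close> into the one with parameters \<open>\<delta>\<close> and \<open>1/2\<close>.
  Positivity of the parameters is the range of \<open>\<delta>\<close>.\<close>

lemma set_integrable_beta_weight:
  assumes "0 < \<delta>" "\<delta> < 1/2"
  shows "set_integrable lborel {0<..} (beta_weight \<delta>)"
proof -
  have "set_integrable lborel {0..1} (\<lambda>t. t powr (1/2 - \<delta> - 1) * (1 - t) powr (1/2 - 1))"
    using assms by (intro integrable_Beta) auto
  then have "set_integrable lborel {0<..1} (\<lambda>t. t powr (1/2 - \<delta> - 1) * (1 - t) powr (1/2 - 1))"
    by (rule set_integrable_subset) auto
  then have 1: "set_integrable lborel {0<..1} (beta_weight \<delta>)"
    by (subst set_integrable_cong[OF refl refl]) (auto simp: beta_weight_def)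
  have "set_integrable lborel {0..1} (\<lambda>t. t powr (\<delta> - 1) * (1 - t) powr (1/2 - 1))"
    using assms by (intro integrable_Beta) auto
  then have "set_integrable lborel {0<..<1} (\<lambda>t. t powr (\<delta> - 1) * (1 - t) powr (1/2 - 1))"
    by (rule set_integrable_subset) auto
  then have "(\<lambda>t. t powr (\<delta> - 1) * (1 - t) powr (1/2 - 1)) absolutely_integrable_on {0<..<1}"
    by (subst (asm) set_integrable_lborel_iff_lebesgue) auto
  \<comment> \<open>The inverted weight contributes \<open>t powr (1 + \<delta>)\<close>, which the
    Jacobian lowers to \<open>t powr (\<delta> - 1)\<close>.\<close>
  moreover have "\<bar>- (1 / t\<^sup>2)\<bar> * beta_weight \<delta> (1 / t) = t powr (\<delta> - 1) * (1 - t) powr (1/2 - 1)"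
    if "t \<in> {0<..<1}" for t
  proof -
    have t: "0 < t" "t < 1" using that by auto
    have "\<bar>1 / t - 1\<bar> = (1 - t) / t" using t by (simp add: field_simps)
    then have "beta_weight \<delta> (1 / t) = t powr (1/2 + \<delta>) * (t powr (1/2) * (1 - t) powr (-1/2))"
      using t by (simp add: beta_weight_def powr_divide powr_minus divide_simps flip: powr_add)
    also have "\<dots> = t powr (1 + \<delta>) * (1 - t) powr (-1/2)"
      by (simp add: powr_add[of t "1/2", symmetric] algebra_simps flip: powr_add)
    finally show ?thesis
      using t by (simp add: powr_diff powr_add power2_eq_square divide_simps)
  qed
  ultimately have "(\<lambda>t. \<bar>- (1 / t\<^sup>2)\<bar> * beta_weight \<delta> (1 / t)) absolutely_integrable_on {0<..<1}"
    by (subst set_integrable_cong[OF refl refl]) auto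
  moreover have "((\<lambda>t. 1 / t) has_field_derivative - (1 / t\<^sup>2)) (at t within {0<..<1})"
    if "t \<in> {0<..<1}" for t :: real
    using that by (auto intro!: derivative_eq_intros simp: power2_eq_square)
  moreover have "inj_on (\<lambda>t::real. 1 / t) {0<..<1}"
    by (auto simp: inj_on_def)
  moreover have "(\<lambda>t::real. 1 / t) ` {0<..<1} = {1<..}"
  proof (intro equalityI subsetI)
    fix y :: real assume "y \<in> {1<..}"
    then show "y \<in> (\<lambda>t::real. 1 / t) ` {0<..<1}"
      by (intro image_eqI[of _ _ "1 / y"]) auto
  qed auto
  ultimately have "beta_weight \<delta> absolutely_integrable_on {1<..}"
    using has_absolute_integral_change_of_variables_1'[of "{0<..<1}" "\<lambda>t. 1 / t"
        "\<lambda>t. - (1 / t\<^sup>2)" "beta_weight \<delta>" "integral {0<..<1} (\<lambda>t. \<bar>- (1 / t\<^sup>2)\<bar> * beta_weight \<delta> (1 / t))"]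
    by simp
  then have 2: "set_integrable lborel {1<..} (beta_weight \<delta>)"
    by (subst set_integrable_lborel_iff_lebesgue) auto
  have "{0<..1} \<union> {1<..} = {0::real<..}" by auto
  then show ?thesis
    using set_integrable_Un[OF 1 2] by simp
qed

section \<open>The Laplace integral for \<open>K0\<close> on the closed upper half-plane\<close>

text \<open>Two specialisations matter: \<open>c = 1\<close>, \<open>u = 2 * z\<close>, which is
  holomorphic in \<open>z\<close>, and the polar form \<open>c = 2 * norm z\<close>,
  \<open>u = sgn z\<close>, which has a majorant locally uniform up to the real axis.\<close>

definition bessel_kernel :: "real \<Rightarrow> complex \<Rightarrow> real \<Rightarrow> complex" where
  "bessel_kernel c u y = of_real (exp (- c * y) / sqrt y) / csqrt (- \<i> * (of_real y + u))"

text \<open>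
  Up to the phase \<open>cis (pi / 4)\<close>, this is \<open>exp z * K\<^sub>0 z\<close>, from \<open>cosh u = 1 + x / z\<close> in the integral for
  \<open>K\<^sub>0\<close>. The factor \<open>- \<i>\<close> in the kernel keeps the radicand in the right half-plane whenever
  \<open>Im z \<ge> 0\<close>, so that the principal root stays continuous up to both halves of the real axis.
\<close>

definition laplace_K0 :: "complex \<Rightarrow> complex" where
  "laplace_K0 z = (LBINT x:{0<..}. bessel_kernel 1 (2 * z) x)"

lemma bessel_kernel_measurable [measurable]: "bessel_kernel c u \<in> borel_measurable borel"
  unfolding bessel_kernel_def by measurable

lemma norm_bessel_kernel:
  "y > 0 \<Longrightarrow> norm (bessel_kernel c u y) = exp (- c * y) / (sqrt y * sqrt (norm (of_real y + u)))"
  by (simp add: bessel_kernel_def norm_divide norm_mult)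

text \<open>
  Scaling the integration variable by \<open>2 * \<bar>z\<bar>\<close> pins the possible singularity of the kernel at
  \<open>y = 1\<close>, independently of \<open>z\<close>; this is what makes dominated convergence work at real \<open>z\<close>.
\<close>

lemma laplace_K0_scale:
  assumes "c > 0"
  shows "(LBINT y:{0<..}. bessel_kernel c u y) = (LBINT x:{0<..}. bessel_kernel 1 (of_real c * u) x)"
proof -
  \<comment> \<open>One factor \<open>sqrt c\<close> comes from \<open>sqrt (c * y)\<close> and one
    from the complex root; together they cancel the Jacobian \<open>c\<close>.\<close>
  have *: "c *\<^sub>R (indicator {0<..} (c * y) *\<^sub>R bessel_kernel 1 (of_real c * u) (c * y)) =
      indicator {0<..} y *\<^sub>R bessel_kernel c u y" for y
  proof (cases "y > 0")
    case True
    have "- \<i> * (of_real (c * y) + of_real c * u) = of_real c * (- \<i> * (of_real y + u))"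
      by (simp add: algebra_simps)
    then have "csqrt (- \<i> * (of_real (c * y) + of_real c * u)) =
        of_real (sqrt c) * csqrt (- \<i> * (of_real y + u))"
      using assms by (simp only: csqrt_of_real_mult less_imp_le)
    moreover have "complex_of_real c = of_real (sqrt c) * of_real (sqrt c)"
      using assms by (simp flip: of_real_mult)
    ultimately show ?thesis
      using assms True
      by (simp add: bessel_kernel_def scaleR_conv_of_real real_sqrt_mult zero_less_mult_iff)
  qed (use assms in \<open>auto simp: zero_less_mult_iff\<close>)
  have "(LBINT x:{0<..}. bessel_kernel 1 (of_real c * u) x) =
      c *\<^sub>R (\<integral>y. indicator {0<..} (c * y) *\<^sub>R bessel_kernel 1 (of_real c * u) (c * y) \<partial>lborel)"
    unfolding set_lebesgue_integral_def
    by (subst lborel_integral_real_affine[of c _ 0]) (use assms in auto)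
  also have "\<dots> = (\<integral>y. indicator {0<..} y *\<^sub>R bessel_kernel c u y \<partial>lborel)"
    by (simp only: * flip: integral_scaleR_right)
  finally show ?thesis by (simp add: set_lebesgue_integral_def)
qed

lemma laplace_K0_polar:
  assumes "z \<noteq> 0"
  shows "laplace_K0 z = (LBINT y:{0<..}. bessel_kernel (2 * norm z) (sgn z) y)"
  using laplace_K0_scale[of "2 * norm z" "sgn z"] assms
  by (simp add: laplace_K0_def sgn_div_norm scaleR_conv_of_real field_simps)

text \<open>Trades exponential decay for power decay with a freely chosen exponent; this is where
  the factor \<open>norm z powr (- \<delta>)\<close> in later bounds originates.\<close>

lemma powr_mult_exp_minus_le_one:
  assumes "x > 0" "0 \<le> \<delta>" "\<delta> \<le> 1"
  shows "x powr \<delta> * exp (- x) \<le> (1 :: real)"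
proof -
  have "x powr \<delta> \<le> 1 + x"
  proof (cases "x \<le> 1")
    case True
    then show ?thesis using powr_le1[of \<delta> x] assms by linarith
  next
    case False
    then show ?thesis using powr_mono[of \<delta> 1 x] assms by simp
  qed
  also have "\<dots> \<le> exp x" by simp
  finally show ?thesis by (simp add: exp_minus divide_simps)
qed

text \<open>The reverse triangle inequality bounds the root from below by its value at
  \<open>u = - 1\<close>. The right-hand side depends on \<open>c\<close> only through the lower
  bound \<open>r\<close> and not on \<open>u\<close>, as domination along a sequence
  requires.\<close>

lemma norm_bessel_kernel_le:
  assumes "y > 0" "y \<noteq> 1" "norm u = 1" "c \<ge> r" "r > 0" "0 < \<delta>" "\<delta> < 1/2"
  shows "norm (bessel_kernel c u y) \<le> r powr (- \<delta>) * beta_weight \<delta> y"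
proof -
  have "\<bar>y - 1\<bar> \<le> norm (of_real y + u)"
    using norm_triangle_ineq3[of "of_real y" "- u"] assms by simp
  moreover have "\<bar>y - 1\<bar> > 0" using assms by simp
  ultimately have 1: "1 / sqrt (norm (of_real y + u)) \<le> \<bar>y - 1\<bar> powr (-1/2)"
    by (simp add: powr_minus powr_half_sqrt divide_simps)
  have "exp (- c * y) \<le> exp (- (r * y))"
    using assms by simp
  also have "\<dots> \<le> (r * y) powr (- \<delta>)"
    using powr_mult_exp_minus_le_one[of "r * y" \<delta>] assms
    by (simp add: powr_minus divide_simps mult_ac)
  finally have 2: "exp (- c * y) \<le> (r * y) powr (- \<delta>)" .
  have "norm (bessel_kernel c u y) =
      exp (- c * y) * (y powr (-1/2) * (1 / sqrt (norm (of_real y + u))))"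
    using assms(1) by (simp add: norm_bessel_kernel powr_minus powr_half_sqrt divide_simps)
  also have "\<dots> \<le> (r * y) powr (- \<delta>) * (y powr (-1/2) * \<bar>y - 1\<bar> powr (-1/2))"
    using 1 2 by (intro mult_mono) auto
  also have "\<dots> = r powr (- \<delta>) * beta_weight \<delta> y"
    using assms powr_add[of y "-1/2" "- \<delta>"] by (simp add: beta_weight_def powr_mult)
  finally show ?thesis .
qed

lemma norm_laplace_K0_le:
  assumes "z \<noteq> 0" "0 < \<delta>" "\<delta> < 1/2"
  shows "norm (laplace_K0 z) \<le> (LBINT y:{0<..}. beta_weight \<delta> y) * norm z powr (- \<delta>)"
proof -
  have "norm (laplace_K0 z) \<le>
      (\<integral>y. norm (indicator {0<..} y *\<^sub>R bessel_kernel (2 * norm z) (sgn z) y) \<partial>lborel)"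
    unfolding laplace_K0_polar[OF assms(1)] set_lebesgue_integral_def by (rule integral_norm_bound)
  also have "\<dots> \<le> (LBINT y:{0<..}. norm z powr (- \<delta>) * beta_weight \<delta> y)"
    unfolding set_lebesgue_integral_def
  proof (rule integral_mono_AE')
    show "integrable lborel (\<lambda>y. indicator {0<..} y *\<^sub>R (norm z powr (- \<delta>) * beta_weight \<delta> y))"
      using set_integrable_mult_right[OF set_integrable_beta_weight[OF assms(2,3)]]
      unfolding set_integrable_def .
    \<comment> \<open>Since \<open>0 powr x = 0\<close>, the weight vanishes at \<open>y = 1\<close>
      and the pointwise bound can fail there, hence the almost-everywhere form. Taking
      \<open>r = norm z\<close> below \<open>c = 2 * norm z\<close> drops a harmless factor.\<close>
    show "AE y in lborel. norm (indicator {0<..} y *\<^sub>R bessel_kernel (2 * norm z) (sgn z) y)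
        \<le> indicator {0<..} y *\<^sub>R (norm z powr (- \<delta>) * beta_weight \<delta> y)"
      using AE_lborel_singleton[of "1::real"]
    proof eventually_elim
      case (elim y)
      then show ?case
        using norm_bessel_kernel_le[of y "sgn z" "norm z" "2 * norm z" \<delta>] assms
        by (auto simp: indicator_def norm_sgn)
    qed
  qed (auto simp: beta_weight_nonneg)
  finally show ?thesis by (simp add: mult.commute)
qed

lemma complex_notin_nonpos_Reals: "Re w \<ge> 0 \<Longrightarrow> w \<noteq> 0 \<Longrightarrow> w \<notin> \<real>\<^sub>\<le>\<^sub>0"
  by (auto simp: complex_nonpos_Reals_iff complex_eq_iff)

text \<open>Dominated convergence in the polar form. Both halves of the real axis belong to the
  domain, so boundary values can be computed by evaluating the integral at real points.\<close>

lemma continuous_on_laplace_K0: "continuous_on {z. 0 \<le> Im z \<and> z \<noteq> 0} laplace_K0"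
  unfolding continuous_on_sequentially o_def
proof (intro allI ballI impI, elim conjE)
  fix X :: "nat \<Rightarrow> complex" and z
  assume z: "z \<in> {z. 0 \<le> Im z \<and> z \<noteq> 0}" and X0: "\<forall>n. X n \<in> {z. 0 \<le> Im z \<and> z \<noteq> 0}"
    and X: "X \<longlonglongrightarrow> z"
  define r where "r = norm z / 2"
  have r: "r > 0" "r < norm z" using z by (auto simp: r_def)
  have "eventually (\<lambda>n. norm (X n) > r) sequentially"
    using tendsto_norm[OF X] r(2) by (rule order_tendstoD)
  then obtain N where N: "\<And>n. n \<ge> N \<Longrightarrow> norm (X n) > r"
    by (auto simp: eventually_sequentially)
  have "(\<lambda>n. LBINT y:{0<..}. bessel_kernel (2 * norm (X (n + N))) (sgn (X (n + N))) y)
      \<longlonglongrightarrow> (LBINT y:{0<..}. bessel_kernel (2 * norm z) (sgn z) y)"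
    unfolding set_lebesgue_integral_def
  proof (rule integral_dominated_convergence)
    \<comment> \<open>Any exponent strictly between \<open>0\<close> and \<open>1/2\<close> serves
      here; \<open>1/4\<close> is the midpoint.\<close>
    show "integrable lborel (\<lambda>y. indicator {0<..} y *\<^sub>R (r powr (- (1/4)) * beta_weight (1/4) y))"
      using set_integrable_mult_right[OF set_integrable_beta_weight[of "1/4"]]
      unfolding set_integrable_def by simp
    show "AE y in lborel. norm (indicator {0<..} y *\<^sub>R
          bessel_kernel (2 * norm (X (n + N))) (sgn (X (n + N))) y)
        \<le> indicator {0<..} y *\<^sub>R (r powr (- (1/4)) * beta_weight (1/4) y)" for n
      using AE_lborel_singleton[of "1::real"]
    proof eventually_elim
      case (elim y)
      then show ?case
        using norm_bessel_kernel_le[of y "sgn (X (n + N))" r "2 * norm (X (n + N))" "1/4"]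
          X0[rule_format, of "n + N"] N[of "n + N"] r(1)
        by (auto simp: indicator_def norm_sgn)
    qed
    show "AE y in lborel.
        (\<lambda>n. indicat_real {0<..} y *\<^sub>R bessel_kernel (2 * norm (X (n + N))) (sgn (X (n + N))) y)
          \<longlonglongrightarrow> indicat_real {0<..} y *\<^sub>R bessel_kernel (2 * norm z) (sgn z) y"
      using AE_lborel_singleton[of "1::real"]
    proof eventually_elim
      case (elim y)
      have XN: "(\<lambda>n. X (n + N)) \<longlonglongrightarrow> z" using X by (rule LIMSEQ_ignore_initial_segment)
      have sg: "(\<lambda>n. sgn (X (n + N))) \<longlonglongrightarrow> sgn z" using XN z by (intro tendsto_sgn) auto
      show ?case
      proof (cases "y > 0")
        case True
        have "\<bar>y - 1\<bar> \<le> norm (of_real y + sgn z)"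
          using norm_triangle_ineq3[of "of_real y" "- sgn z"] z True by (simp add: norm_sgn)
        then have "of_real y + sgn z \<noteq> 0" using elim by auto
        moreover have "0 \<le> Im (sgn z)" using z by (simp add: sgn_div_norm)
        \<comment> \<open>The real part of the radicand is \<open>Im (sgn z)\<close>, which is
          nonnegative, so a nonzero radicand avoids the branch cut.\<close>
        ultimately have "- \<i> * (of_real y + sgn z) \<notin> \<real>\<^sub>\<le>\<^sub>0"
          by (intro complex_notin_nonpos_Reals) auto
        then have "(\<lambda>n. csqrt (- \<i> * (of_real y + sgn (X (n + N)))))
            \<longlonglongrightarrow> csqrt (- \<i> * (of_real y + sgn z))"
          using sg by (intro isCont_tendsto_compose[OF continuous_at_csqrt]) (auto intro!: tendsto_intros)
        then show ?thesis
          unfolding bessel_kernel_def using True XN \<open>of_real y + sgn z \<noteq> 0\<close>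
          by (auto intro!: tendsto_intros)
      qed auto
    qed
  qed auto
  then have "(\<lambda>n. laplace_K0 (X (n + N))) \<longlonglongrightarrow> laplace_K0 z"
    using X0 z by (simp add: laplace_K0_polar)
  then show "(\<lambda>n. laplace_K0 (X n)) \<longlonglongrightarrow> laplace_K0 z" by (rule LIMSEQ_offset)
qed

text \<open>The Gamma integral at \<open>1/2\<close>, used as majorant on half-planes
  \<open>b < Im z\<close>.\<close>

lemma set_integrable_exp_over_sqrt: "set_integrable lborel {0<..} (\<lambda>x::real. exp (- x) / sqrt x)"
proof -
  have "((\<lambda>t. t powr (1/2 - 1) / exp t) has_integral Gamma (1/2 :: real)) {0..}"
    by (intro Gamma_integral_real) auto
  then have "(\<lambda>t::real. t powr (1/2 - 1) / exp t) absolutely_integrable_on {0..}"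
    by (intro nonnegative_absolutely_integrable_1) (auto simp: integrable_on_def)
  then have "set_integrable lborel {0..} (\<lambda>t::real. t powr (1/2 - 1) / exp t)"
    by (subst set_integrable_lborel_iff_lebesgue) auto
  then have "set_integrable lborel {0<..} (\<lambda>t::real. t powr (1/2 - 1) / exp t)"
    by (rule set_integrable_subset) auto
  then show ?thesis
    by (subst set_integrable_cong[OF refl refl])
      (auto simp: powr_minus powr_half_sqrt exp_minus divide_simps)
qed

text \<open>Here the unscaled kernel is used, because \<open>norm z\<close> and \<open>sgn z\<close>
  are not holomorphic. For \<open>b < Im z\<close> the radicand has modulus at least
  \<open>b\<close>, which gives a majorant on that half-plane; these half-planes exhaust the open
  upper one.\<close>

lemma holomorphic_on_laplace_K0: "laplace_K0 holomorphic_on {z. 0 < Im z}"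
proof -
  have "laplace_K0 holomorphic_on {z. b < Im z}" if b: "b > 0" for b
    unfolding laplace_K0_def set_lebesgue_integral_def
  proof (rule holomorphic_on_lebesgue_integral)
    show "integrable lborel (\<lambda>x::real. indicator {0<..} x *\<^sub>R (1 / sqrt b * (exp (- x) / sqrt x)))"
      using set_integrable_mult_right[OF set_integrable_exp_over_sqrt, of "1 / sqrt b"]
      unfolding set_integrable_def .
    show "open {z. b < Im z}" by (rule open_halfspace_Im_gt)
    show "(\<lambda>z. indicat_real {0<..} x *\<^sub>R bessel_kernel 1 (2 * z) x) holomorphic_on {z. b < Im z}"
      if "x \<in> space lborel" for x
    proof -
      have "- \<i> * (of_real x + 2 * z) \<notin> \<real>\<^sub>\<le>\<^sub>0" "- \<i> * (of_real x + 2 * z) \<noteq> 0" if "b < Im z" for z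
        using complex_notin_nonpos_Reals[of "- \<i> * (of_real x + 2 * z)"] that b
        by (auto simp: complex_eq_iff simp del: mult_minus_left)
      then show ?thesis
        unfolding bessel_kernel_def scaleR_conv_of_real by (intro holomorphic_intros) auto
    qed
    show "norm (indicat_real {0<..} x *\<^sub>R bessel_kernel 1 (2 * z) x)
        \<le> indicator {0<..} x *\<^sub>R (1 / sqrt b * (exp (- x) / sqrt x))"
      if z: "z \<in> {z. b < Im z}" for z x
    proof (cases "x > 0")
      case True
      have "b \<le> norm (of_real x + 2 * z)"
        using abs_Im_le_cmod[of "of_real x + 2 * z"] z b by simp
      then have "1 / sqrt (norm (of_real x + 2 * z)) \<le> 1 / sqrt b"
        using b by (intro divide_left_mono) (auto intro!: mult_pos_pos)
      then have "exp (- x) / sqrt x * (1 / sqrt (norm (of_real x + 2 * z)))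
          \<le> exp (- x) / sqrt x * (1 / sqrt b)"
        using True by (intro mult_left_mono) auto
      then show ?thesis using True by (simp add: norm_bessel_kernel mult.commute)
    qed auto
  qed auto
  then have "laplace_K0 holomorphic_on (\<Union>b\<in>{0<..}. {z. b < Im z})"
    by (intro holomorphic_on_UN_open) (auto simp: open_halfspace_Im_gt)
  moreover have "(\<Union>b\<in>{0<..}. {z. b < Im z}) = {z. 0 < Im z}"
    using dense by force
  ultimately show ?thesis by simp
qed

lemma set_integrable_bessel_kernel:
  assumes "c > 0" "norm u = 1"
  shows "set_integrable lborel {0<..} (bessel_kernel c u)"
  unfolding set_integrable_def
proof (rule Bochner_Integration.integrable_bound)
  show "integrable lborel (\<lambda>y. indicator {0<..} y *\<^sub>R (c powr (- (1/4)) * beta_weight (1/4) y))"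
    using set_integrable_mult_right[OF set_integrable_beta_weight[of "1/4"]]
    unfolding set_integrable_def by simp
  show "AE y in lborel. norm (indicat_real {0<..} y *\<^sub>R bessel_kernel c u y)
      \<le> norm (indicator {0<..} y *\<^sub>R (c powr (- (1/4)) * beta_weight (1/4) y))"
    using AE_lborel_singleton[of "1::real"]
  proof eventually_elim
    case (elim y)
    then show ?case
      using norm_bessel_kernel_le[of y u c c "1/4"] assms
      by (auto simp: indicator_def beta_weight_nonneg)
  qed
qed auto

section \<open>Boundary values of the Laplace integral on the real axis\<close>

text \<open>Modulus of the kernel at a real shift \<open>s\<close>. The choices \<open>s = 1\<close>
  and \<open>s = - 1\<close> are the integrands of \<open>K0\<close> and \<open>I0\<close> in
  algebraic coordinates.\<close>

definition bessel_density :: "real \<Rightarrow> real \<Rightarrow> real \<Rightarrow> real" where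
  "bessel_density c s y = exp (- c * y) / (sqrt y * sqrt \<bar>y + s\<bar>)"

lemma bessel_density_measurable [measurable]: "bessel_density c s \<in> borel_measurable borel"
  unfolding bessel_density_def by measurable

lemma set_integrable_bessel_density:
  assumes "c > 0" "\<bar>s\<bar> = 1"
  shows "set_integrable lborel {0<..} (bessel_density c s)"
proof -
  have "set_integrable lborel {0<..} (\<lambda>y. norm (bessel_kernel c (of_real s) y))"
    using assms by (intro set_integrable_norm set_integrable_bessel_kernel) auto
  moreover have "norm (bessel_kernel c (of_real s) y) = bessel_density c s y" if "y > 0" for y
    using norm_bessel_kernel[OF that, of c "of_real s"]
    by (simp add: bessel_density_def flip: of_real_add)
  ultimately show ?thesis
    by (subst set_integrable_cong[OF refl refl, symmetric]) auto
qed

text \<open>Passes to the completed measure, substitutes there, and returns to \<open>lborel\<close>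
  through the measurability of \<open>h\<close>. The transformed integrand is supplied as
  \<open>h\<close>, already simplified.\<close>

lemma set_integral_change_of_variables:
  fixes f g g' h :: "real \<Rightarrow> real"
  assumes f: "set_integrable lborel (g ` S) f"
    and S: "S \<in> sets borel" "g ` S \<in> sets borel"
    and der: "\<And>x. x \<in> S \<Longrightarrow> (g has_real_derivative g' x) (at x)"
    and inj: "inj_on g S"
    and h: "h \<in> borel_measurable borel" "\<And>x. x \<in> S \<Longrightarrow> \<bar>g' x\<bar> * f (g x) = h x"
  shows "set_integrable lborel S h" "(LBINT x:S. h x) = (LBINT y:g ` S. f y)"
proof -
  have "f absolutely_integrable_on g ` S"
    using f S unfolding set_integrable_def by (auto intro: integrable_completion[THEN iffD2])
  then have *: "(\<lambda>x. \<bar>g' x\<bar> * f (g x)) absolutely_integrable_on S \<and>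
      integral S (\<lambda>x. \<bar>g' x\<bar> * f (g x)) = integral (g ` S) f"
    using has_absolute_integral_change_of_variables_1'[of S g g' f "integral (g ` S) f"]
      S der inj by (auto intro: has_field_derivative_at_within)
  moreover have "set_integrable lebesgue S (\<lambda>x. \<bar>g' x\<bar> * f (g x)) \<longleftrightarrow> h absolutely_integrable_on S"
    by (rule set_integrable_cong) (use h in auto)
  ultimately show 1: "set_integrable lborel S h"
    using set_integrable_lborel_iff_lebesgue[OF S(1) h(1)] by simp
  have "integral S h = integral S (\<lambda>x. \<bar>g' x\<bar> * f (g x))"
    by (rule integral_cong) (simp add: h(2))
  then show "(LBINT x:S. h x) = (LBINT y:g ` S. f y)"
    using * by (simp add: set_borel_integral_eq_integral(2) f 1)
qed

text \<open>Substitute \<open>y = (cosh u - 1) / 2\<close>: then \<open>y * (y + 1)\<close> is the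
  square of \<open>sinh u / 2\<close>, so the two roots cancel the Jacobian.\<close>

lemma bessel_K0_eq_density:
  assumes "t > 0"
  shows "(LBINT y:{0<..}. bessel_density (2 * t) 1 y) = exp t * bessel_K0 t"
proof -
  let ?g = "\<lambda>u::real. (cosh u - 1) / 2"
  have im: "?g ` {0<..} = {0<..}"
  proof (intro equalityI subsetI)
    fix y :: real assume "y \<in> {0<..}"
    then show "y \<in> ?g ` {0<..}"
      using arcosh_real_strict_mono[of 1 "1 + 2 * y"]
      by (intro image_eqI[of _ _ "arcosh (1 + 2 * y)"]) auto
  next
    fix y :: real assume "y \<in> ?g ` {0<..}"
    then show "y \<in> {0<..}" using cosh_real_strict_mono[of 0] by force
  qed
  have inj: "inj_on ?g {0<..}"
  proof (rule inj_onI)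
    fix u v :: real assume "u \<in> {0<..}" "v \<in> {0<..}" "?g u = ?g v"
    then show "u = v"
      using cosh_real_strict_mono[of u v] cosh_real_strict_mono[of v u]
      by (cases u v rule: linorder_cases) auto
  qed
  have der: "(?g has_real_derivative sinh u / 2) (at u)" for u
    by (auto intro!: derivative_eq_intros)
  have eq: "\<bar>sinh u / 2\<bar> * bessel_density (2 * t) 1 (?g u) = exp t * exp (- t * cosh u)"
    if "u \<in> {0<..}" for u
  proof -
    have s: "sinh u > 0" using that by simp
    have g: "?g u \<ge> 0" using cosh_real_ge_1[of u] by simp
    have "?g u * (?g u + 1) = (sinh u / 2)\<^sup>2"
      by (simp add: field_simps power2_eq_square sinh_square_eq[unfolded power2_eq_square])
    then have "sqrt (?g u) * sqrt \<bar>?g u + 1\<bar> = sinh u / 2"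
      using s g by (simp flip: real_sqrt_mult)
    moreover have "exp (- (2 * t) * ?g u) = exp t * exp (- t * cosh u)"
      by (simp add: field_simps flip: exp_add)
    ultimately show ?thesis
      unfolding bessel_density_def using s by (simp only:) simp
  qed
  have meas [measurable]: "(\<lambda>u. exp (- t * cosh u)) \<in> borel_measurable borel"
    by (intro borel_measurable_continuous_onI continuous_intros)
  have "(LBINT u:{0<..}. exp t * exp (- t * cosh u)) = (LBINT y:{0<..}. bessel_density (2 * t) 1 y)"
    using set_integral_change_of_variables(2)[of ?g "{0<..}" "bessel_density (2 * t) 1"
        "\<lambda>u. sinh u / 2" "\<lambda>u. exp t * exp (- t * cosh u)"]
      set_integrable_bessel_density[of "2 * t" 1] assms im inj der eq
    by (simp add: borel_measurable_continuous_onI continuous_intros)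
  moreover have "(LBINT u:{0<..}. exp (- t * cosh u)) = bessel_K0 t"
    unfolding bessel_K0_def set_lebesgue_integral_def
  proof (rule integral_cong_AE)
    show "AE u in lborel. indicat_real {0<..} u *\<^sub>R exp (- t * cosh u) =
        indicat_real {0..} u *\<^sub>R exp (- t * cosh u)"
      using AE_lborel_singleton[of "0::real"] by eventually_elim (auto simp: indicator_def)
  qed (use meas in auto)
  ultimately show ?thesis by simp
qed

text \<open>The trigonometric counterpart \<open>y = (1 - cos u) / 2\<close>, where
  \<open>y * (1 - y)\<close> is the square of \<open>sin u / 2\<close>.\<close>

lemma bessel_I0_eq_density:
  assumes "t > 0"
  shows "(LBINT y:{0<..<1}. bessel_density (2 * t) (-1) y) = exp (- t) * (pi * bessel_I0 t)"
proof -
  let ?g = "\<lambda>u::real. (1 - cos u) / 2"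
  have im: "?g ` {0<..<pi} = {0<..<1}"
  proof (intro equalityI subsetI)
    fix y :: real assume "y \<in> {0<..<1}"
    then show "y \<in> ?g ` {0<..<pi}"
      using arccos_lt_bounded[of "1 - 2 * y"]
      by (intro image_eqI[of _ _ "arccos (1 - 2 * y)"]) auto
  next
    fix y :: real assume "y \<in> ?g ` {0<..<pi}"
    then obtain u where "0 < u" "u < pi" "y = ?g u" by auto
    moreover have "cos u < 1" "cos pi < cos u"
      using cos_monotone_0_pi[of 0 u] cos_monotone_0_pi[of u pi] \<open>0 < u\<close> \<open>u < pi\<close> by auto
    ultimately show "y \<in> {0<..<1}" by (simp add: field_simps)
  qed
  have inj: "inj_on ?g {0<..<pi}"
    by (rule inj_onI) (use cos_inj_pi in auto)
  have der: "(?g has_real_derivative sin u / 2) (at u)" for u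
    by (auto intro!: derivative_eq_intros)
  have eq: "\<bar>sin u / 2\<bar> * bessel_density (2 * t) (-1) (?g u) = exp (- t) * exp (t * cos u)"
    if "u \<in> {0<..<pi}" for u
  proof -
    have s: "sin u > 0" using that by (simp add: sin_gt_zero)
    have g: "?g u \<ge> 0" "?g u \<le> 1" using cos_le_one[of u] cos_ge_minus_one[of u] by auto
    then have "\<bar>?g u - 1\<bar> = 1 - ?g u" by (simp only: abs_of_nonpos)
    note g = g this
    have "?g u * (1 - ?g u) = (sin u / 2)\<^sup>2"
      by (simp add: field_simps power2_eq_square sin_squared_eq[unfolded power2_eq_square])
    then have "sqrt (?g u) * sqrt \<bar>?g u + -1\<bar> = sin u / 2"
      using s g by (simp flip: real_sqrt_mult)
    moreover have "exp (- (2 * t) * ?g u) = exp (- t) * exp (t * cos u)"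
      by (simp add: field_simps flip: exp_add)
    ultimately show ?thesis
      unfolding bessel_density_def using s by (simp only:) simp
  qed
  have "set_integrable lborel {0<..<1} (bessel_density (2 * t) (-1))"
    by (rule set_integrable_subset[OF set_integrable_bessel_density]) (use assms in auto)
  then have "(LBINT u:{0<..<pi}. exp (- t) * exp (t * cos u)) =
      (LBINT y:{0<..<1}. bessel_density (2 * t) (-1) y)"
    using set_integral_change_of_variables(2)[of ?g "{0<..<pi}" "bessel_density (2 * t) (-1)"
        "\<lambda>u. sin u / 2" "\<lambda>u. exp (- t) * exp (t * cos u)"] im inj der eq
    by (simp add: borel_measurable_continuous_onI continuous_intros)
  moreover have "(LBINT u:{0<..<pi}. exp (t * cos u)) = pi * bessel_I0 t"
  proof -
    have "(LBINT u:{0<..<pi}. exp (t * cos u)) = (LBINT u:{0..pi}. exp (t * cos u))"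
      unfolding set_lebesgue_integral_def
    proof (rule integral_cong_AE)
      show "AE u in lborel. indicat_real {0<..<pi} u *\<^sub>R exp (t * cos u) =
          indicat_real {0..pi} u *\<^sub>R exp (t * cos u)"
        using AE_lborel_singleton[of "0::real"] AE_lborel_singleton[of pi]
        by eventually_elim (auto simp: indicator_def)
    qed auto
    then show ?thesis by (simp add: bessel_I0_def)
  qed
  ultimately show ?thesis by simp
qed

lemma csqrt_ii_mult:
  assumes "a \<ge> 0"
  shows "csqrt (\<i> * of_real a) = of_real (sqrt a) * cis (pi / 4)"
    and "csqrt (- \<i> * of_real a) = of_real (sqrt a) * cis (- pi / 4)"
proof -
  have 1: "csqrt \<i> = cis (pi / 4)"
    by (rule csqrt_unique) (simp_all add: power2_eq_square cis_mult cos_45)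
  have "csqrt (- \<i>) = cis (- pi / 4)"
    by (rule csqrt_unique) (simp_all add: power2_eq_square cis_mult cos_45)
  with 1 show "csqrt (\<i> * of_real a) = of_real (sqrt a) * cis (pi / 4)"
    "csqrt (- \<i> * of_real a) = of_real (sqrt a) * cis (- pi / 4)"
    using csqrt_of_real_mult[OF assms, of \<i>] csqrt_of_real_mult[OF assms, of "- \<i>"]
    by (simp_all add: mult.commute)
qed

text \<open>For real shifts the radicand is imaginary and its root has argument
  \<open>- pi / 4\<close> or \<open>pi / 4\<close> according to the sign of \<open>y + s\<close>. At
  \<open>y + s = 0\<close> both sides are \<open>0\<close> by the convention for division, so the
  two cases agree.\<close>

lemma bessel_kernel_of_real:
  assumes "y > 0"
  shows "y + s \<ge> 0 \<Longrightarrow> bessel_kernel c (of_real s) y = cis (pi / 4) * of_real (bessel_density c s y)"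
    and "y + s \<le> 0 \<Longrightarrow> bessel_kernel c (of_real s) y = cis (- pi / 4) * of_real (bessel_density c s y)"
proof -
  assume "y + s \<ge> 0"
  then show "bessel_kernel c (of_real s) y = cis (pi / 4) * of_real (bessel_density c s y)"
    using csqrt_ii_mult(2)[of "y + s"]
    by (simp add: bessel_kernel_def bessel_density_def cis_divide divide_simps cis_mult)
next
  assume "y + s \<le> 0"
  moreover have "- \<i> * (of_real y + of_real s) = \<i> * complex_of_real (- (y + s))"
    by (simp add: algebra_simps)
  ultimately show "bessel_kernel c (of_real s) y = cis (- pi / 4) * of_real (bessel_density c s y)"
    using csqrt_ii_mult(1)[of "- (y + s)"]
    by (simp add: bessel_kernel_def bessel_density_def cis_divide divide_simps cis_mult
        del: mult_minus_left mult_minus_right)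
qed

lemma laplace_K0_pos:
  assumes "t > 0"
  shows "laplace_K0 (of_real t) = cis (pi / 4) * of_real (exp t * bessel_K0 t)"
proof -
  have "laplace_K0 (of_real t) = (LBINT y:{0<..}. bessel_kernel (2 * t) 1 y)"
    using assms by (subst laplace_K0_polar) (auto simp: sgn_of_real)
  also have "\<dots> = (LBINT y:{0<..}. cis (pi / 4) * of_real (bessel_density (2 * t) 1 y))"
    by (rule set_lebesgue_integral_cong) (use bessel_kernel_of_real(1)[of _ 1 "2 * t"] in auto)
  also have "\<dots> = cis (pi / 4) * of_real (LBINT y:{0<..}. bessel_density (2 * t) 1 y)"
    by (simp only: set_integral_mult_right set_integral_complex_of_real)
  finally show ?thesis using bessel_K0_eq_density[OF assms] by simp
qed

text \<open>The connection formula for \<open>K0\<close> at \<open>- t\<close>, approached through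
  the upper half-plane. The phase of the kernel jumps at \<open>y = 1\<close>: the part below gives
  \<open>I0\<close>, the part above gives \<open>K0\<close>.\<close>

lemma laplace_K0_neg:
  assumes "t > 0"
  shows "laplace_K0 (- of_real t) =
    cis (pi / 4) * of_real (exp (- t)) * (of_real (bessel_K0 t) - \<i> * of_real (pi * bessel_I0 t))"
proof -
  let ?k = "bessel_kernel (2 * t) (-1)"
  have int: "set_integrable lborel {0<..} ?k"
    using assms by (intro set_integrable_bessel_kernel) auto
  have "laplace_K0 (- of_real t) = (LBINT y:{0<..}. ?k y)"
    using assms by (subst laplace_K0_polar) (auto simp: sgn_of_real sgn_minus)
  also have "\<dots> = (LBINT y:{0<..<1} \<union> {1<..}. ?k y)"
    unfolding set_lebesgue_integral_def
  proof (rule integral_cong_AE)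
    show "AE y in lborel. indicat_real {0<..} y *\<^sub>R ?k y =
        indicat_real ({0<..<1} \<union> {1<..}) y *\<^sub>R ?k y"
      using AE_lborel_singleton[of "1::real"] by eventually_elim (auto simp: indicator_def)
  qed auto
  also have "\<dots> = (LBINT y:{0<..<1}. ?k y) + (LBINT y:{1<..}. ?k y)"
    by (intro set_integral_Un set_integrable_subset[OF int]) auto
  also have "(LBINT y:{0<..<1}. ?k y) =
      (LBINT y:{0<..<1}. cis (- pi / 4) * of_real (bessel_density (2 * t) (-1) y))"
    by (rule set_lebesgue_integral_cong) (use bessel_kernel_of_real(2)[of _ "-1" "2 * t"] in auto)
  also have "\<dots> = cis (- pi / 4) * of_real (exp (- t) * (pi * bessel_I0 t))"
    by (simp only: set_integral_mult_right set_integral_complex_of_real bessel_I0_eq_density[OF assms])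
  also have "(LBINT y:{1<..}. ?k y) =
      (LBINT y:{1<..}. cis (pi / 4) * of_real (bessel_density (2 * t) (-1) y))"
    by (rule set_lebesgue_integral_cong) (use bessel_kernel_of_real(1)[of _ "-1" "2 * t"] in auto)
  also have "\<dots> = cis (pi / 4) * of_real (LBINT y:{1<..}. bessel_density (2 * t) (-1) y)"
    by (simp only: set_integral_mult_right set_integral_complex_of_real)
  \<comment> \<open>The shift \<open>y = v + 1\<close> exchanges the two square roots and releases
    the factor \<open>exp (- (2 * t))\<close>.\<close>
  also have "(LBINT y:{1<..}. bessel_density (2 * t) (-1) y) =
      (LBINT v:{0<..}. exp (- (2 * t)) * bessel_density (2 * t) 1 v)"
    unfolding set_lebesgue_integral_def
    by (subst lborel_integral_real_affine[of 1 _ 1])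
      (auto intro!: Bochner_Integration.integral_cong
        simp: indicator_def bessel_density_def ring_distribs exp_add[symmetric] mult_ac)
  also have "\<dots> = exp (- (2 * t)) * (exp t * bessel_K0 t)"
    by (simp only: set_integral_mult_right bessel_K0_eq_density[OF assms])
  also have "exp (- (2 * t)) * (exp t * bessel_K0 t) = exp (- t) * bessel_K0 t"
    by (simp flip: exp_add mult.assoc)
  also have "cis (- pi / 4) = cis (pi / 4) * (- \<i>)"
    by (simp add: cis_mult flip: cis_minus_pi_half)
  finally show ?thesis by (simp add: algebra_simps)
qed

section \<open>Moving a contour across a strip\<close>

lemma contour_integral_linepath_same_Im:
  assumes "p < q" and "g contour_integrable_on linepath (Complex p c) (Complex q c)"
  shows "contour_integral (linepath (Complex p c) (Complex q c)) g = integral {p..q} (\<lambda>x. g (Complex x c))"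
proof -
  let ?I = "contour_integral (linepath (Complex p c) (Complex q c)) g"
  have "linepath (Complex p c) (Complex q c) x = linepath (of_real p) (of_real q) x + \<i> * of_real c"
    "Complex q c - Complex p c = of_real q - of_real p" for x
    by (auto simp: linepath_def complex_eq_iff algebra_simps)
  moreover have "(g has_contour_integral ?I) (linepath (Complex p c) (Complex q c))"
    using assms(2) by (rule has_contour_integral_integral)
  ultimately have "((\<lambda>w. g (w + \<i> * of_real c)) has_contour_integral ?I)
      (linepath (of_real p) (of_real q))"
    by (simp add: has_contour_integral_linepath)
  then have "((\<lambda>x. g (of_real x + \<i> * of_real c)) has_integral ?I) {p..q}"
    using assms(1) by (subst (asm) has_contour_integral_linepath_Reals_iff) auto
  then show ?thesis by (simp add: integral_unique Complex_eq)
qed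

text \<open>In logarithmic coordinates the sector becomes a strip, which is convex.\<close>

lemma strip_integrals_tendsto:
  fixes g :: "complex \<Rightarrow> complex"
  assumes "a > 0"
    and cont: "continuous_on {w. 0 \<le> Im w \<and> Im w \<le> a} g"
    and diff: "\<And>w. 0 < Im w \<Longrightarrow> Im w < a \<Longrightarrow> g field_differentiable (at w)"
    and bound: "\<And>w. 0 \<le> Im w \<Longrightarrow> Im w \<le> a \<Longrightarrow> norm (g w) \<le> B \<bar>Re w\<bar>"
    and B: "(B \<longlongrightarrow> 0) at_top"
  shows "((\<lambda>U. integral {-U..U} (\<lambda>x. g (Complex x 0)) - integral {-U..U} (\<lambda>x. g (Complex x a)))
    \<longlongrightarrow> 0) at_top"
proof (rule Lim_null_comparison)
  show "((\<lambda>U. 2 * (B U * a)) \<longlongrightarrow> 0) at_top"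
    by (rule tendsto_eq_intros B refl)+ simp
  show "eventually (\<lambda>U. norm (integral {-U..U} (\<lambda>x. g (Complex x 0)) -
      integral {-U..U} (\<lambda>x. g (Complex x a))) \<le> 2 * (B U * a)) at_top"
    using eventually_gt_at_top[of 0]
  proof eventually_elim
    case (elim U)
    define S where "S = {w. 0 \<le> Im w \<and> Im w \<le> a}"
    define z1 z2 z3 z4 where z: "z1 = Complex (-U) 0" "z2 = Complex U 0" "z3 = Complex U a"
      "z4 = Complex (-U) a"
    have S_eq: "S = {w. Im w \<ge> 0} \<inter> {w. Im w \<le> a}" by (auto simp: S_def)
    have convex: "convex S"
      unfolding S_eq by (intro convex_Int convex_halfspace_Im_ge convex_halfspace_Im_le)
    have zS: "z1 \<in> S" "z2 \<in> S" "z3 \<in> S" "z4 \<in> S"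
      using \<open>a > 0\<close> by (auto simp: z S_def)
    have seg: "closed_segment u v \<subseteq> S" if "u \<in> S" "v \<in> S" for u v
      using convex that by (simp add: closed_segment_subset)
    have gint: "g contour_integrable_on linepath u v" if "u \<in> S" "v \<in> S" for u v
      using continuous_on_subset[OF cont[folded S_def] seg[OF that]]
      by (rule contour_integrable_continuous_linepath)
    have interior: "interior S \<subseteq> {w. 0 < Im w \<and> Im w < a}"
      using interior_halfspace_ge[of \<i> 0] interior_halfspace_le[of \<i> a] by (simp add: S_eq subset_iff)
    \<comment> \<open>This form of Cauchy's theorem asks for continuity on the closed strip and
      differentiability only inside, matching what is known about the boundary values.\<close>
    have "(g has_contour_integral 0)
        (linepath z1 z2 +++ linepath z2 z3 +++ linepath z3 z4 +++ linepath z4 z1)"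
    proof (rule Cauchy_theorem_convex[of S g "{}"])
      show "continuous_on S g" using cont by (simp add: S_def)
      show "g field_differentiable at w" if "w \<in> interior S - {}" for w
        using that interior diff by auto
      show "path_image (linepath z1 z2 +++ linepath z2 z3 +++ linepath z3 z4 +++ linepath z4 z1) \<subseteq> S"
        using seg zS by (auto simp: path_image_join)
    qed (use convex in auto)
    then have "contour_integral (linepath z1 z2) g + (contour_integral (linepath z2 z3) g +
        (contour_integral (linepath z3 z4) g + contour_integral (linepath z4 z1) g)) = 0"
      using gint zS by (auto dest!: contour_integral_unique simp: contour_integrable_joinI)
    moreover have "contour_integral (linepath z1 z2) g = integral {-U..U} (\<lambda>x. g (Complex x 0))"
      using elim gint[OF \<open>z1 \<in> S\<close> \<open>z2 \<in> S\<close>] unfolding z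
      by (intro contour_integral_linepath_same_Im) auto
    moreover have "contour_integral (linepath z4 z3) g = integral {-U..U} (\<lambda>x. g (Complex x a))"
      using elim gint[OF \<open>z4 \<in> S\<close> \<open>z3 \<in> S\<close>] unfolding z
      by (intro contour_integral_linepath_same_Im) auto
    moreover have "contour_integral (linepath z3 z4) g = - contour_integral (linepath z4 z3) g"
      by (rule contour_integral_reverse_linepath)
        (use continuous_on_subset[OF cont[folded S_def] seg] zS in auto)
    ultimately have "integral {-U..U} (\<lambda>x. g (Complex x 0)) - integral {-U..U} (\<lambda>x. g (Complex x a))
        = - contour_integral (linepath z2 z3) g - contour_integral (linepath z4 z1) g"
      by (simp add: algebra_simps eq_neg_iff_add_eq_0)
    \<comment> \<open>On the vertical sides \<open>\<bar>Re w\<bar> = U\<close>, so each of them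
      contributes at most \<open>B U\<close> times its length.\<close>
    moreover have "norm (contour_integral (linepath u v) g) \<le> B U * norm (v - u)"
      if "u \<in> S" "v \<in> S" "\<bar>Re u\<bar> = U" "Re v = Re u" for u v
    proof (rule contour_integral_bound_linepath)
      show "norm (g w) \<le> B U" if "w \<in> closed_segment u v" for w
      proof -
        have "w \<in> S" using seg \<open>u \<in> S\<close> \<open>v \<in> S\<close> that by auto
        moreover have "Re w = Re u"
          using that \<open>Re v = Re u\<close> closed_segment_same_Re[of u v] by simp
        ultimately show ?thesis using bound[of w] \<open>\<bar>Re u\<bar> = U\<close> by (simp add: S_def)
      qed
      show "0 \<le> B U"
        using bound[of u] that by (auto simp: S_def intro: order.trans[OF norm_ge_zero])
    qed (use gint that in auto)
    from this[of z2 z3] this[of z4 z1]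
    have "norm (contour_integral (linepath z2 z3) g) \<le> B U * a"
      "norm (contour_integral (linepath z4 z1) g) \<le> B U * a"
      using zS elim \<open>a > 0\<close> by (simp_all add: z cmod_def)
    ultimately show ?case
      using norm_triangle_ineq4[of "- contour_integral (linepath z2 z3) g" "contour_integral (linepath z4 z1) g"]
      by simp
  qed
qed

section \<open>The product of the two continuations and its growth\<close>

text \<open>The map \<open>z\<close> to \<open>- cnj z\<close> reflects the upper half-plane in the
  imaginary axis, and the outer conjugation makes the second factor holomorphic again. Phases
  \<open>cis (pi / 4)\<close> and exponentials cancel between the factors, leaving the product of
  \<open>K0\<close> at \<open>z\<close> and at \<open>- z\<close>.\<close>

definition bessel_product :: "complex \<Rightarrow> complex" where
  "bessel_product z = laplace_K0 z * cnj (laplace_K0 (- cnj z))"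

lemma continuous_on_bessel_product: "continuous_on {z. 0 \<le> Im z \<and> z \<noteq> 0} bessel_product"
proof -
  have "continuous_on {z. 0 \<le> Im z \<and> z \<noteq> 0} (\<lambda>z. laplace_K0 (- cnj z))"
    by (rule continuous_on_compose2[OF continuous_on_laplace_K0]) (auto intro!: continuous_intros)
  then show ?thesis
    unfolding bessel_product_def[abs_def] by (intro continuous_intros continuous_on_laplace_K0)
qed

text \<open>Conjugating both argument and value of a function holomorphic on the lower half-plane
  gives one holomorphic on the upper half-plane.\<close>

lemma bessel_product_differentiable:
  assumes "Im z > 0"
  shows "bessel_product field_differentiable (at z)"
proof -
  have "(\<lambda>z. laplace_K0 (- z)) holomorphic_on {z. Im z < 0}"
    using holomorphic_on_compose_gen[OF holomorphic_on_minus[OF holomorphic_on_ident]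
        holomorphic_on_laplace_K0, of "{z. Im z < 0}"]
    by (simp add: o_def image_subset_iff)
  then have "(cnj \<circ> (\<lambda>z. laplace_K0 (- z)) \<circ> cnj) holomorphic_on {z. Im z > 0}"
    by (intro holomorphic_on_compose_cnj_cnj)
      (auto simp: open_halfspace_Im_gt elim!: holomorphic_on_subset)
  then have "bessel_product holomorphic_on {z. Im z > 0}"
    unfolding bessel_product_def[abs_def] o_def
    by (intro holomorphic_intros holomorphic_on_laplace_K0)
  then show ?thesis
    using assms open_halfspace_Im_gt[of 0] holomorphic_on_imp_differentiable_at by blast
qed

text \<open>Points of the imaginary axis are fixed by the reflection, so the product is a squared
  modulus.\<close>

lemma bessel_product_imaginary: "bessel_product (\<i> * of_real y) \<in> \<real>"
  by (simp add: bessel_product_def complex_mult_cnj)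

lemma bessel_product_pos:
  assumes "t > 0"
  shows "bessel_product (of_real t) =
    of_real (bessel_K0 t) * (of_real (bessel_K0 t) + \<i> * of_real (pi * bessel_I0 t))"
proof -
  have "cis (pi / 4) * cnj (cis (pi / 4)) = 1"
    by (simp add: cis_cnj cis_mult)
  moreover have "complex_of_real (exp t) * of_real (exp (- t)) = 1"
    by (simp flip: of_real_mult exp_add)
  ultimately show ?thesis
    unfolding bessel_product_def laplace_K0_pos[OF assms] complex_cnj_minus complex_cnj_complex_of_real
      laplace_K0_neg[OF assms]
    by (simp add: mult_ac)
qed

lemma norm_bessel_product_le:
  assumes "0 < \<delta>" "\<delta> < 1"
  obtains C where "C \<ge> 0" "\<And>z. z \<noteq> 0 \<Longrightarrow> norm (bessel_product z) \<le> C * norm z powr (- \<delta>)"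
proof
  \<comment> \<open>Each factor receives half of the exponent, which brings
    \<open>\<delta> / 2\<close> into the range where the weight is integrable.\<close>
  define C where "C = (LBINT y:{0<..}. beta_weight (\<delta> / 2) y)"
  show "0 \<le> C\<^sup>2" by simp
  fix z :: complex assume z: "z \<noteq> 0"
  have "norm (laplace_K0 z) \<le> C * norm z powr (- (\<delta> / 2))"
    "norm (laplace_K0 (- cnj z)) \<le> C * norm z powr (- (\<delta> / 2))"
    using norm_laplace_K0_le[of z "\<delta> / 2"] norm_laplace_K0_le[of "- cnj z" "\<delta> / 2"] assms z
    by (auto simp: C_def)
  moreover from this(1) have "0 \<le> C * norm z powr (- (\<delta> / 2))"
    by (rule order.trans[OF norm_ge_zero])
  ultimately have "norm (bessel_product z) \<le>
      (C * norm z powr (- (\<delta> / 2))) * (C * norm z powr (- (\<delta> / 2)))"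
    unfolding bessel_product_def norm_mult complex_mod_cnj
    by (intro mult_mono) auto
  also have "\<dots> = C\<^sup>2 * norm z powr (- \<delta>)"
    by (simp add: power2_eq_square flip: powr_add)
  finally show "norm (bessel_product z) \<le> C\<^sup>2 * norm z powr (- \<delta>)" .
qed

lemma norm_bessel_product_power_le:
  assumes "0 < \<delta>" "\<delta> < 1"
  obtains C where "C \<ge> 0" "\<And>z. z \<noteq> 0 \<Longrightarrow>
    norm (bessel_product z ^ n * z ^ p) \<le> C * norm z powr (real p - \<delta> * real n)"
proof -
  obtain C where C: "C \<ge> 0" "\<And>z. z \<noteq> 0 \<Longrightarrow> norm (bessel_product z) \<le> C * norm z powr (- \<delta>)"
    using norm_bessel_product_le[OF assms] by metis
  show ?thesis
  proof
    show "C ^ n \<ge> 0" using C by simp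
    fix z :: complex assume z: "z \<noteq> 0"
    have "norm (bessel_product z ^ n * z ^ p) \<le> (C * norm z powr (- \<delta>)) ^ n * norm z ^ p"
      unfolding norm_mult norm_power by (intro mult_right_mono power_mono C z) auto
    also have "\<dots> = C ^ n * norm z powr (real p - \<delta> * real n)"
      using z by (simp add: power_mult_distrib powr_diff powr_realpow powr_powr[symmetric] powr_minus
          divide_simps flip: powr_power)
    finally show "norm (bessel_product z ^ n * z ^ p) \<le> C ^ n * norm z powr (real p - \<delta> * real n)" .
  qed
qed

text \<open>The right-hand exponential is the smaller of \<open>norm z powr (1/2)\<close> and
  \<open>norm z powr (-1/2)\<close>. The power of \<open>z\<close> is one higher than in the moment
  because the substitution \<open>z = exp w\<close> contributes a factor \<open>z\<close>.\<close>

lemma bessel_product_moment_bound: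
  assumes "2 * k \<le> n" "1 \<le> k"
  obtains D where "D \<ge> 0" "\<And>z. z \<noteq> 0 \<Longrightarrow>
    norm (bessel_product z ^ n * z ^ (n - 2 * k + 1)) \<le> D * exp (- \<bar>ln (norm z)\<bar> / 2)"
proof -
  let ?p = "n - 2 * k + 1"
  have n: "n \<ge> 2" using assms by simp
  \<comment> \<open>The small choice leaves the exponent \<open>n - 2 * k + 1/2\<close>, at least
    \<open>1/2\<close>, for use near the origin. The large one leaves \<open>3/2 - 2 * k\<close>, at
    most \<open>- 1/2\<close> because \<open>k\<close> is at least \<open>1\<close>, for use at
    infinity.\<close>
  have \<delta>: "0 < 1 / (2 * real n)" "1 / (2 * real n) < 1" "0 < 1 - 1 / (2 * real n)" "1 - 1 / (2 * real n) < 1"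
    using n by (auto simp: field_simps)
  obtain C1 where C1: "C1 \<ge> 0" "\<And>z. z \<noteq> 0 \<Longrightarrow> norm (bessel_product z ^ n * z ^ ?p) \<le>
      C1 * norm z powr (real ?p - 1 / (2 * real n) * real n)"
    using norm_bessel_product_power_le[OF \<delta>(1,2)] by metis
  obtain C2 where C2: "C2 \<ge> 0" "\<And>z. z \<noteq> 0 \<Longrightarrow> norm (bessel_product z ^ n * z ^ ?p) \<le>
      C2 * norm z powr (real ?p - (1 - 1 / (2 * real n)) * real n)"
    using norm_bessel_product_power_le[OF \<delta>(3,4)] by metis
  show ?thesis
  proof
    show "max C1 C2 \<ge> 0" using C1(1) by simp
    fix z :: complex assume z: "z \<noteq> 0"
    then have r: "norm z > 0" by simp
    have p: "real ?p = real n - 2 * real k + 1" using assms by (simp add: of_nat_diff)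
    show "norm (bessel_product z ^ n * z ^ ?p) \<le> max C1 C2 * exp (- \<bar>ln (norm z)\<bar> / 2)"
    proof (cases "norm z \<le> 1")
      case True
      have "norm z powr (real ?p - 1 / (2 * real n) * real n) \<le> norm z powr (1 / 2)"
        using r True assms n by (intro powr_mono') auto
      also have "\<dots> = exp (- \<bar>ln (norm z)\<bar> / 2)"
        using r True by (simp add: powr_def)
      finally show ?thesis
        using C1(2)[OF z] C1(1) by (meson max.cobounded1 mult_mono order.trans powr_ge_zero le_max_iff_disj)
    next
      case False
      have "real ?p - (1 - 1 / (2 * real n)) * real n \<le> - (1 / 2)"
        using n assms unfolding p by (simp add: field_simps)
      then have "norm z powr (real ?p - (1 - 1 / (2 * real n)) * real n) \<le> norm z powr (- (1 / 2))"
        using False by (intro powr_mono) auto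
      also have "\<dots> = exp (- \<bar>ln (norm z)\<bar> / 2)"
        using r False by (simp add: powr_def)
      finally show ?thesis
        using C2(2)[OF z] C2(1) by (meson max.cobounded2 mult_mono order.trans powr_ge_zero le_max_iff_disj)
    qed
  qed
qed

section \<open>Finite sums and the real part of a binomial power\<close>

lemma set_integral_sum:
  fixes f :: "'i \<Rightarrow> 'a \<Rightarrow> 'b :: {banach, second_countable_topology}"
  assumes "\<And>i. i \<in> I \<Longrightarrow> set_integrable M A (f i)"
  shows "set_integrable M A (\<lambda>x. \<Sum>i\<in>I. f i x)"
    and "(LINT x:A|M. \<Sum>i\<in>I. f i x) = (\<Sum>i\<in>I. LINT x:A|M. f i x)"
  using assms unfolding set_integrable_def set_lebesgue_integral_def
  by (simp_all add: scaleR_sum_right)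

text \<open>In the binomial expansion the odd powers of \<open>- \<i> * b\<close> are imaginary, and
  the even ones are real with sign \<open>(-1) ^ m\<close>.\<close>

lemma Re_diff_ii_power:
  fixes a b :: real
  shows "Re ((of_real a - \<i> * of_real b) ^ n) =
    (\<Sum>m = 0..n div 2. (-1) ^ m * real (n choose (2 * m)) * (a ^ (n - 2 * m) * b ^ (2 * m)))"
proof -
  let ?f = "\<lambda>j. of_nat (n choose j) * (- (\<i> * of_real b)) ^ j * complex_of_real a ^ (n - j)"
  have even_power: "(- (\<i> * of_real b)) ^ (2 * m) = complex_of_real ((-1) ^ m * b ^ (2 * m))" for m
  proof -
    have "(- (\<i> * of_real b)) ^ 2 = complex_of_real (- (b ^ 2))"
      by (simp add: power_mult_distrib)
    then have "(- (\<i> * of_real b)) ^ (2 * m) = complex_of_real ((- (b ^ 2)) ^ m)"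
      by (simp only: power_mult of_real_power)
    then show ?thesis by (simp only: power_minus[of "b ^ 2"] power_mult)
  qed
  have even: "Re (?f (2 * m)) = (-1) ^ m * real (n choose (2 * m)) * (a ^ (n - 2 * m) * b ^ (2 * m))"
    for m
  proof -
    have "?f (2 * m) = of_real ((-1) ^ m * real (n choose (2 * m)) * (a ^ (n - 2 * m) * b ^ (2 * m)))"
      unfolding even_power by (simp add: mult_ac)
    then show ?thesis by (simp only: Re_complex_of_real)
  qed
  have odd: "Re (?f j) = 0" if "odd j" for j
  proof -
    obtain m where j: "j = 2 * m + 1" using \<open>odd j\<close> by (rule oddE)
    have pow: "(- (\<i> * of_real b)) ^ j = - (\<i> * of_real b) * complex_of_real ((-1) ^ m * b ^ (2 * m))"
      unfolding j power_add even_power by (simp only: power_one_right mult.commute)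
    have "?f j = \<i> * of_real (- ((-1) ^ m * real (n choose j) * (a ^ (n - j) * b ^ j)))"
      unfolding pow by (simp add: j mult_ac)
    then show ?thesis by (simp only: Re_i_times Im_complex_of_real)
  qed
  have "(of_real a - \<i> * of_real b) ^ n = (\<Sum>j\<le>n. ?f j)"
    using binomial_ring[of "- (\<i> * of_real b)" "of_real a" n] by (simp only: uminus_add_conv_diff)
  then have "Re ((of_real a - \<i> * of_real b) ^ n) = (\<Sum>j\<le>n. Re (?f j))"
    by (simp only: Re_sum)
  also have "\<dots> = (\<Sum>j\<in>(*) 2 ` {0..n div 2}. Re (?f j))"
  proof (rule sum.mono_neutral_right)
    show "\<forall>j\<in>{..n} - (*) 2 ` {0..n div 2}. Re (?f j) = 0"
    proof
      fix j assume j: "j \<in> {..n} - (*) 2 ` {0..n div 2}"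
      have "odd j"
      proof
        assume "even j"
        then have "j = 2 * (j div 2)" "j div 2 \<in> {0..n div 2}" using j by (auto intro: div_le_mono)
        then show False using j by blast
      qed
      then show "Re (?f j) = 0" by (rule odd)
    qed
  qed auto
  also have "\<dots> = (\<Sum>m = 0..n div 2. Re (?f (2 * m)))"
    by (subst sum.reindex) (auto simp: inj_on_def)
  finally show ?thesis by (simp only: even)
qed

section \<open>Moment integrands on the positive axis\<close>

text \<open>This formula and the next one for \<open>bessel_I0\<close> solve the boundary value
  identities for the Bessel functions, which thereby inherit continuity from
  \<open>laplace_K0\<close>.\<close>

lemma bessel_K0_eq_laplace: "t > 0 \<Longrightarrow> bessel_K0 t = exp (- t) * Re (cis (- pi / 4) * laplace_K0 (of_real t))"
proof -
  assume "t > 0"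
  then have "cis (- pi / 4) * laplace_K0 (of_real t) = of_real (exp t * bessel_K0 t)"
    by (simp add: laplace_K0_pos cis_mult flip: mult.assoc)
  then show ?thesis by (simp only: Re_complex_of_real) (simp add: exp_minus)
qed

lemma bessel_I0_eq_laplace:
  "t > 0 \<Longrightarrow> bessel_I0 t = - exp t * Im (cis (- pi / 4) * laplace_K0 (- of_real t)) / pi"
proof -
  assume "t > 0"
  then have "cis (- pi / 4) * laplace_K0 (- of_real t) =
      of_real (exp (- t)) * (of_real (bessel_K0 t) - \<i> * of_real (pi * bessel_I0 t))"
    by (simp add: laplace_K0_neg cis_mult flip: mult.assoc)
  then have "Im (cis (- pi / 4) * laplace_K0 (- of_real t)) = - exp (- t) * (pi * bessel_I0 t)"
    by simp
  then show ?thesis by (simp add: exp_minus)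
qed

lemma continuous_on_bessel_K0: "continuous_on {0<..} bessel_K0"
proof -
  have "continuous_on {0<..} (\<lambda>t::real. laplace_K0 (of_real t))"
    by (rule continuous_on_compose2[OF continuous_on_laplace_K0]) (auto intro!: continuous_intros)
  then have "continuous_on {0<..} (\<lambda>t. exp (- t) * Re (cis (- pi / 4) * laplace_K0 (of_real t)))"
    by (intro continuous_intros)
  then show ?thesis by (rule continuous_on_eq) (simp add: bessel_K0_eq_laplace)
qed

lemma continuous_on_bessel_I0: "continuous_on {0<..} bessel_I0"
proof -
  have "continuous_on {0<..} (\<lambda>t::real. laplace_K0 (- of_real t))"
    by (rule continuous_on_compose2[OF continuous_on_laplace_K0]) (auto intro!: continuous_intros)
  then have "continuous_on {0<..} (\<lambda>t. - exp t * Im (cis (- pi / 4) * laplace_K0 (- of_real t)) / pi)"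
    by (intro continuous_intros) auto
  then show ?thesis by (rule continuous_on_eq) (simp add: bessel_I0_eq_laplace)
qed

lemma continuous_on_bessel_moment_integrand:
  "continuous_on {0<..} (bessel_moment_integrand n k m)"
  unfolding bessel_moment_integrand_def[abs_def]
  by (intro continuous_intros continuous_on_bessel_K0 continuous_on_bessel_I0)

text \<open>Both \<open>K0\<close> and \<open>pi * I0\<close> are coordinates of the complex number
  \<open>K0 + \<i> * pi * I0\<close>, so the growth bound for the product controls every
  summand.\<close>

lemma abs_bessel_moment_integrand_le:
  assumes "t > 0" "2 * m \<le> n"
  shows "\<bar>bessel_moment_integrand n k m t\<bar> \<le>
    norm (bessel_product (of_real t) ^ n * of_real t ^ (n - 2 * k))"
proof -
  let ?I = "pi * bessel_I0 t" and ?K = "bessel_K0 t"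
  let ?w = "complex_of_real ?K + \<i> * of_real ?I"
  have "\<bar>?K\<bar> \<le> norm ?w" "\<bar>?I\<bar> \<le> norm ?w"
    using abs_Re_le_cmod[of ?w] abs_Im_le_cmod[of ?w] by auto
  then have "\<bar>?I\<bar> ^ (n - 2 * m) * \<bar>?K\<bar> ^ (2 * m) \<le> norm ?w ^ (n - 2 * m) * norm ?w ^ (2 * m)"
    by (intro mult_mono power_mono) auto
  also have "\<dots> = norm ?w ^ n" using assms(2) by (simp flip: power_add)
  finally have "\<bar>?K\<bar> ^ n * (\<bar>?I\<bar> ^ (n - 2 * m) * \<bar>?K\<bar> ^ (2 * m)) * \<bar>t\<bar> ^ (n - 2 * k)
      \<le> \<bar>?K\<bar> ^ n * norm ?w ^ n * \<bar>t\<bar> ^ (n - 2 * k)"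
    by (intro mult_right_mono mult_left_mono) auto
  then show ?thesis
    unfolding bessel_product_pos[OF assms(1)] bessel_moment_integrand_def
    by (simp add: abs_mult power_abs norm_mult norm_power power_mult_distrib power_add mult_ac)
qed

lemma sum_bessel_moment_integrand:
  assumes "t > 0"
  shows "(\<Sum>m = 0..n div 2. (-1) ^ m * real (n choose (2 * m)) * bessel_moment_integrand n k m t) =
    Re ((- \<i>) ^ n * (bessel_product (of_real t) ^ n * of_real t ^ (n - 2 * k)))"
proof -
  let ?I = "pi * bessel_I0 t" and ?K = "bessel_K0 t"
  have "- \<i> * bessel_product (of_real t) = of_real ?K * (of_real ?I - \<i> * of_real ?K)"
    unfolding bessel_product_pos[OF assms] by (simp add: algebra_simps)
  then have "(- \<i>) ^ n * (bessel_product (of_real t) ^ n * of_real t ^ (n - 2 * k)) =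
      (of_real ?K * (of_real ?I - \<i> * of_real ?K)) ^ n * of_real t ^ (n - 2 * k)"
    by (simp only: mult.assoc[symmetric] power_mult_distrib[symmetric])
  also have "\<dots> = of_real (?K ^ n * t ^ (n - 2 * k)) * (of_real ?I - \<i> * of_real ?K) ^ n"
    by (simp add: power_mult_distrib mult_ac)
  also have "Re \<dots> = ?K ^ n * t ^ (n - 2 * k) * Re ((of_real ?I - \<i> * of_real ?K) ^ n)"
    by (simp only: Re_complex_of_real Im_complex_of_real times_complex.sel mult_zero_left diff_zero)
  also have "\<dots> = (\<Sum>m = 0..n div 2. (-1) ^ m * real (n choose (2 * m)) * bessel_moment_integrand n k m t)"
    unfolding Re_diff_ii_power sum_distrib_left bessel_moment_integrand_def
    by (intro sum.cong) (simp_all add: power_add mult_ac)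
  finally show ?thesis by simp
qed

text \<open>The function is \<open>t powr (- (1/2))\<close> up to \<open>1\<close> and
  \<open>t powr (- (3/2))\<close> beyond.\<close>

lemma set_integrable_exp_abs_ln: "set_integrable lborel {0<..} (\<lambda>t::real. exp (- \<bar>ln t\<bar> / 2) / t)"
proof -
  have "(\<lambda>t::real. t powr (- (1/2))) absolutely_integrable_on {0<..1}"
    by (intro nonnegative_absolutely_integrable_1 integrable_on_powr_from_0') auto
  then have "set_integrable lborel {0<..1} (\<lambda>t::real. t powr (- (1/2)))"
    by (subst set_integrable_lborel_iff_lebesgue) auto
  moreover have "t powr (- (1/2)) = exp (- \<bar>ln t\<bar> / 2) / t" if "t \<in> {0<..1}" for t :: real
    using that exp_diff[of "ln t / 2" "ln t"] by (simp add: powr_def)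
  ultimately have 1: "set_integrable lborel {0<..1} (\<lambda>t::real. exp (- \<bar>ln t\<bar> / 2) / t)"
    using set_integrable_cong[OF refl refl, of "{0<..1}" "\<lambda>t. t powr (- (1/2))"
        "\<lambda>t. exp (- \<bar>ln t\<bar> / 2) / t" lborel] by blast
  have "(\<lambda>t::real. t powr (- (3/2))) absolutely_integrable_on {1..}"
    using has_integral_powr_to_inf[of "- (3/2)" 1]
    by (intro nonnegative_absolutely_integrable_1) (auto simp: integrable_on_def)
  then have "set_integrable lborel {1..} (\<lambda>t::real. t powr (- (3/2)))"
    by (subst set_integrable_lborel_iff_lebesgue) auto
  moreover have "t powr (- (3/2)) = exp (- \<bar>ln t\<bar> / 2) / t" if "t \<in> {1..}" for t :: real
    using that exp_diff[of "- ln t / 2" "ln t"] by (simp add: powr_def)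
  ultimately have 2: "set_integrable lborel {1..} (\<lambda>t::real. exp (- \<bar>ln t\<bar> / 2) / t)"
    using set_integrable_cong[OF refl refl, of "{1..}" "\<lambda>t. t powr (- (3/2))"
        "\<lambda>t. exp (- \<bar>ln t\<bar> / 2) / t" lborel] by blast
  have "{0<..1} \<union> {1..} = {0::real<..}" by auto
  then show ?thesis using set_integrable_Un[OF 1 2] by simp
qed

lemma set_integrable_bessel_moment_integrand:
  assumes "2 * k \<le> n" "1 \<le> k" "2 * m \<le> n"
  shows "set_integrable lborel {0<..} (bessel_moment_integrand n k m)"
proof -
  obtain D where D: "D \<ge> 0" "\<And>z. z \<noteq> 0 \<Longrightarrow>
      norm (bessel_product z ^ n * z ^ (n - 2 * k + 1)) \<le> D * exp (- \<bar>ln (norm z)\<bar> / 2)"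
    using bessel_product_moment_bound[OF assms(1,2)] by metis
  show ?thesis
    unfolding set_integrable_def
  proof (rule Bochner_Integration.integrable_bound)
    show "integrable lborel (\<lambda>t. indicator {0<..} t *\<^sub>R (D * (exp (- \<bar>ln t\<bar> / 2) / t)))"
      using set_integrable_mult_right[OF set_integrable_exp_abs_ln, of D]
      unfolding set_integrable_def .
    show "(\<lambda>t. indicat_real {0<..} t *\<^sub>R bessel_moment_integrand n k m t) \<in> borel_measurable lborel"
      using borel_measurable_continuous_on_indicator[OF _ continuous_on_bessel_moment_integrand]
      by simp
    show "AE t in lborel. norm (indicat_real {0<..} t *\<^sub>R bessel_moment_integrand n k m t) \<le>
        norm (indicator {0<..} t *\<^sub>R (D * (exp (- \<bar>ln t\<bar> / 2) / t)))"
    proof (intro AE_I2)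
      fix t :: real
      show "norm (indicat_real {0<..} t *\<^sub>R bessel_moment_integrand n k m t) \<le>
          norm (indicator {0<..} t *\<^sub>R (D * (exp (- \<bar>ln t\<bar> / 2) / t)))"
      proof (cases "t > 0")
        case True
        \<comment> \<open>Multiplication by \<open>t\<close> raises the exponent to
          \<open>n - 2 * k + 1\<close>, for which the bound was proved.\<close>
        have "\<bar>bessel_moment_integrand n k m t\<bar> * t \<le>
            norm (bessel_product (of_real t) ^ n * of_real t ^ (n - 2 * k)) * t"
          using abs_bessel_moment_integrand_le[OF True assms(3)] True by (intro mult_right_mono) auto
        also have "\<dots> = norm (bessel_product (of_real t) ^ n * of_real t ^ (n - 2 * k + 1))"
          using True by (simp add: norm_mult norm_power)
        also have "\<dots> \<le> D * exp (- \<bar>ln t\<bar> / 2)"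
          using D(2)[of "of_real t"] True by simp
        finally show ?thesis using True D(1) by (simp add: pos_le_divide_eq)
      qed auto
    qed
  qed
qed

section \<open>Rotation of the ray and vanishing of the integral\<close>

text \<open>Under \<open>t = exp x\<close> the positive axis becomes the lower edge of the strip of
  height \<open>pi / 2\<close> and the positive imaginary axis the upper edge. The truncated
  integrals of \<open>h\<close> tend to \<open>0\<close> by the shift across the strip and to the
  full integral by dominated convergence.\<close>

lemma integral_sum_bessel_moment_integrand:
  assumes "2 * k \<le> n" "1 \<le> k"
  shows "(LBINT t:{0<..}. Re ((- \<i>) ^ n * (bessel_product (of_real t) ^ n * of_real t ^ (n - 2 * k)))) = 0"
proof -
  define p where "p = n - 2 * k"
  define s where "s t = Re ((- \<i>) ^ n * (bessel_product (of_real t) ^ n * of_real t ^ p))" for t :: real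
  define g where "g w = bessel_product (exp w) ^ n * exp w ^ (p + 1)" for w
  define h where "h x = Re ((- \<i>) ^ n * g (Complex x 0))" for x
  obtain D where D: "D \<ge> 0" "\<And>z. z \<noteq> 0 \<Longrightarrow>
      norm (bessel_product z ^ n * z ^ (p + 1)) \<le> D * exp (- \<bar>ln (norm z)\<bar> / 2)"
    using bessel_product_moment_bound[OF assms] unfolding p_def by metis
  have exp_upper: "0 \<le> Im (exp w)" if "0 \<le> Im w" "Im w \<le> pi / 2" for w
    using that by (simp add: Im_exp sin_ge_zero)
  have g_cont: "continuous_on {w. 0 \<le> Im w \<and> Im w \<le> pi / 2} g"
  proof -
    have "continuous_on {w. 0 \<le> Im w \<and> Im w \<le> pi / 2} (\<lambda>w. bessel_product (exp w))"
      by (rule continuous_on_compose2[OF continuous_on_bessel_product])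
        (auto intro!: continuous_intros exp_upper)
    then show ?thesis unfolding g_def[abs_def] by (intro continuous_intros)
  qed
  have lim: "((\<lambda>U. integral {-U..U} (\<lambda>x. g (Complex x 0)) - integral {-U..U} (\<lambda>x. g (Complex x (pi / 2))))
      \<longlongrightarrow> 0) at_top"
  proof (rule strip_integrals_tendsto[OF _ g_cont])
    show "g field_differentiable at w" if "0 < Im w" "Im w < pi / 2" for w
    proof -
      have "Im (exp w) > 0" using that by (simp add: Im_exp sin_gt_zero)
      then have "(bessel_product \<circ> exp) field_differentiable at w"
        by (intro field_differentiable_compose bessel_product_differentiable field_differentiable_within_exp)
      then show ?thesis
        unfolding g_def[abs_def] o_def
        by (intro field_differentiable_mult field_differentiable_power field_differentiable_within_exp)
    qed
    \<comment> \<open>The modulus of \<open>exp w\<close> is \<open>exp (Re w)\<close>, so the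
      logarithm in the bound is \<open>Re w\<close>.\<close>
    show "norm (g w) \<le> D * exp (- \<bar>Re w\<bar> / 2)" for w
      using D(2)[of "exp w"] by (simp add: g_def)
    show "((\<lambda>u. D * exp (- u / 2)) \<longlongrightarrow> 0) at_top"
      by real_asymp
  qed auto
  have "(\<lambda>x. g (Complex x c)) integrable_on {-U..U}" if "0 \<le> c" "c \<le> pi / 2" for U c
    by (intro integrable_continuous_interval continuous_on_compose2[OF g_cont])
      (use that in \<open>auto simp: Complex_eq intro!: continuous_intros\<close>)
  note g_int = this[of 0] this[of "pi / 2"]
  have Re_int: "Re ((- \<i>) ^ n * integral {-U..U} f) = integral {-U..U} (\<lambda>x. Re ((- \<i>) ^ n * f x))"
    if "f integrable_on {-U..U}" for f :: "real \<Rightarrow> complex" and U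
    using has_integral_Re[OF has_integral_mult_right[OF integrable_integral[OF that], of "(- \<i>) ^ n"]]
    by (rule integral_unique[symmetric])
  have "Re ((- \<i>) ^ n * g (Complex x (pi / 2))) = 0" for x
  proof -
    have e: "exp (Complex x (pi / 2)) = \<i> * of_real (exp x)"
      by (simp add: complex_eq_iff Re_exp Im_exp)
    obtain b where b: "bessel_product (\<i> * of_real (exp x)) = of_real b"
      using bessel_product_imaginary[of "exp x"] by (auto elim: Reals_cases)
    \<comment> \<open>The even difference between \<open>n\<close> and \<open>p\<close> decides the
      outcome: \<open>(- \<i>) ^ (2 * k)\<close> is real, and the single factor \<open>\<i>\<close>
      from the Jacobian makes the integrand imaginary.\<close>
    have "n = p + 2 * k" using assms by (simp add: p_def)
    then have "(- \<i>) ^ n * \<i> ^ (p + 1) = ((- \<i>) ^ p * \<i> ^ p) * (- \<i>) ^ (2 * k) * \<i>"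
      by (simp only: power_add power_one_right mult.assoc mult.left_commute mult.commute)
    also have "(- \<i>) ^ p * \<i> ^ p = 1" by (simp flip: power_mult_distrib)
    also have "(- \<i>) ^ (2 * k) = complex_of_real ((-1) ^ k)" by (simp add: power_mult)
    finally have phase: "(- \<i>) ^ n * \<i> ^ (p + 1) = 1 * of_real ((-1) ^ k) * \<i>" .
    have "(- \<i>) ^ n * g (Complex x (pi / 2)) =
        ((- \<i>) ^ n * \<i> ^ (p + 1)) * of_real (b ^ n * exp x ^ (p + 1))"
      unfolding g_def e b power_mult_distrib of_real_mult of_real_power by (simp only: mult_ac)
    also have "\<dots> = \<i> * of_real ((-1) ^ k * (b ^ n * exp x ^ (p + 1)))"
      unfolding phase of_real_mult by (simp only: mult_ac mult_1)
    finally have "(- \<i>) ^ n * g (Complex x (pi / 2)) =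
        \<i> * of_real ((-1) ^ k * (b ^ n * exp x ^ (p + 1)))" .
    then show ?thesis by (simp only: Re_i_times Im_complex_of_real)
  qed
  then have upper: "Re ((- \<i>) ^ n * integral {-U..U} (\<lambda>x. g (Complex x (pi / 2)))) = 0" for U
    using g_int(2) by (subst Re_int) auto
  have lower: "Re ((- \<i>) ^ n * integral {-U..U} (\<lambda>x. g (Complex x 0))) = integral {-U..U} h" for U
    using g_int(1) by (subst Re_int) (auto simp: h_def[abs_def])
  have "((\<lambda>U. Re ((- \<i>) ^ n * (integral {-U..U} (\<lambda>x. g (Complex x 0)) -
      integral {-U..U} (\<lambda>x. g (Complex x (pi / 2)))))) \<longlongrightarrow> Re ((- \<i>) ^ n * 0)) at_top"
    by (intro tendsto_Re tendsto_mult tendsto_const lim)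
  then have lim0: "((\<lambda>U. integral {-U..U} h) \<longlongrightarrow> 0) at_top"
    by (simp only: right_diff_distrib minus_complex.sel upper lower) simp
  have s_eq: "s t = (\<Sum>m = 0..n div 2. (-1) ^ m * real (n choose (2 * m)) * bessel_moment_integrand n k m t)"
    if "t > 0" for t
    unfolding s_def p_def using sum_bessel_moment_integrand[OF that] by simp
  have "set_integrable lborel {0<..} (\<lambda>t. \<Sum>m = 0..n div 2.
      (-1) ^ m * real (n choose (2 * m)) * bessel_moment_integrand n k m t)"
    by (intro set_integral_sum(1) set_integrable_mult_right set_integrable_bessel_moment_integrand assms) auto
  then have s_int: "set_integrable lborel {0<..} s"
    by (subst set_integrable_cong[OF refl refl]) (auto simp: s_eq)
  have h_eq: "h x = \<bar>exp x\<bar> * s (exp x)" for x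
    by (simp add: h_def s_def g_def Complex_eq exp_of_real mult_ac)
  have "continuous_on UNIV (\<lambda>x. g (Complex x 0))"
    by (rule continuous_on_compose2[OF g_cont]) (auto simp: Complex_eq intro!: continuous_intros)
  then have h_cont: "continuous_on UNIV h"
    unfolding h_def[abs_def] by (intro continuous_intros)
  have range_exp: "range exp = {0::real<..}"
  proof (intro equalityI subsetI)
    show "y \<in> range exp" if "y \<in> {0<..}" for y :: real
      using that by (intro image_eqI[of _ _ "ln y"]) auto
  qed auto
  have s_int': "set_integrable lborel (range exp) s" "range exp \<in> sets (borel :: real measure)"
    using s_int by (simp_all add: range_exp)
  have inj_exp: "inj (exp :: real \<Rightarrow> real)" by (simp add: inj_on_def)
  note change = set_integral_change_of_variables[OF s_int'(1) _ s_int'(2) DERIV_exp inj_exp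
      borel_measurable_continuous_onI[OF h_cont] h_eq[symmetric], unfolded range_exp]
  have h_int: "set_integrable lborel UNIV h" by (rule change(1)) simp
  have "(LBINT x:UNIV. h x) = (LBINT t:{0<..}. s t)" by (rule change(2)) simp
  moreover have "((\<lambda>U. integral {-U..U} h) \<longlongrightarrow> (LBINT x:UNIV. h x)) at_top"
  proof -
    have "((\<lambda>U. \<integral>x. indicator {-U..U} x *\<^sub>R h x \<partial>lborel) \<longlongrightarrow> (\<integral>x. h x \<partial>lborel)) at_top"
    proof (rule integral_dominated_convergence_at_top)
      \<comment> \<open>Absolute integrability of \<open>h\<close>, inherited from the moments,
        identifies the limit of symmetric truncations with the Lebesgue integral.\<close>
      show "integrable lborel (\<lambda>x. \<bar>h x\<bar>)" using h_int by (simp add: set_integrable_def)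
      show "AE x in lborel. ((\<lambda>U. indicat_real {-U..U} x *\<^sub>R h x) \<longlongrightarrow> h x) at_top"
      proof (intro AE_I2 tendsto_eventually)
        fix x :: real
        show "eventually (\<lambda>U. indicat_real {-U..U} x *\<^sub>R h x = h x) at_top"
          using eventually_ge_at_top[of "\<bar>x\<bar>"] by eventually_elim (auto simp: indicator_def)
      qed
    qed (use borel_measurable_continuous_onI[OF h_cont] in \<open>auto simp: indicator_def\<close>)
    moreover have "(\<integral>x. indicator {-U..U} x *\<^sub>R h x \<partial>lborel) = integral {-U..U} h" for U
      using set_borel_integral_eq_integral(2)[OF set_integrable_subset[OF h_int], of "{-U..U}"]
      by (simp add: set_lebesgue_integral_def)
    ultimately show ?thesis by (simp add: set_lebesgue_integral_def)
  qed
  ultimately show ?thesis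
    using tendsto_unique[OF _ lim0] by (simp add: s_def[abs_def] p_def)
qed

theorem theorem3p3:
  fixes n k :: nat
  assumes "n \<ge> 2 * k" and "2 * k \<ge> 2"
  shows "(\<forall>m \<le> n div 2. set_integrable lborel {0<..} (bessel_moment_integrand n k m)) \<and>
         (\<Sum>m = 0..n div 2. (-1) ^ m * real (n choose (2 * m)) *
            (LBINT t:{0<..}. bessel_moment_integrand n k m t)) = 0"
proof
  have k: "2 * k \<le> n" "1 \<le> k" using assms by auto
  \<comment> \<open>A Lebesgue integral takes the default value \<open>0\<close> when the integrand
    is not integrable, so integrability gives the vanishing sum its intended meaning.\<close>
  show int: "\<forall>m \<le> n div 2. set_integrable lborel {0<..} (bessel_moment_integrand n k m)"
    using set_integrable_bessel_moment_integrand[OF k] by auto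
  have "(\<Sum>m = 0..n div 2. (-1) ^ m * real (n choose (2 * m)) *
        (LBINT t:{0<..}. bessel_moment_integrand n k m t)) =
      (LBINT t:{0<..}. \<Sum>m = 0..n div 2.
        (-1) ^ m * real (n choose (2 * m)) * bessel_moment_integrand n k m t)"
    using int by (subst set_integral_sum(2)) auto
  also have "\<dots> = (LBINT t:{0<..}.
      Re ((- \<i>) ^ n * (bessel_product (of_real t) ^ n * of_real t ^ (n - 2 * k))))"
    by (rule set_lebesgue_integral_cong) (auto simp: sum_bessel_moment_integrand)
  also have "\<dots> = 0"
    by (rule integral_sum_bessel_moment_integrand[OF k])
  finally show "(\<Sum>m = 0..n div 2. (-1) ^ m * real (n choose (2 * m)) *
      (LBINT t:{0<..}. bessel_moment_integrand n k m t)) = 0" .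
qed

end
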